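(* Define $\Phi:\mathcal R\to\mathbb Z^{\mathbb N}$ by $\Phi(S)=\langle S(\mathbf e^n)\rangle_{n\in\mathbb N}$. Then: (i) $\Phi$ is a ring homomorphism whose kernel $\mathfrak K$ is disjoint from $\mathcal R^+$, and the range of $\Phi$ is the subring $\mathbb P=\{g:\mathbb N\to\mathbb Z: \exists k,m\ \forall n>m\ |g(n)|<n^k\}$ of polynomially bounded sequences. (ii) Let $\approx$ be an asymptotic equinumerosity with numerosity function $\mathfrak n:\mathbf F\to\mathfrak N$, and let $\mathfrak R$ be the ring generated by $\mathfrak N$. Then there is a unique ring homomorphism $\psi$ of $\mathbb P$ onto $\mathfrak R$ such that $\psi(\Phi(S_X))=\mathfrak n(X)$ for all $X\in\mathbf F$. (iii) Under the hypotheses of (ii), there is a quasi-selective ultrafilter $\mathcal U$ on $\mathbb N$ such that for every $g\in\mathbb P$: $g\in\ker\psi$ iff $Z(g)=\{n: g(n)=0\}\in\mathcal U$. In particular, for all $X,Y\in\mathbf F$: $X\approx Y$ iff $\{n\in\mathbb N: |X_n|=|Y_n|\}\in\mathcal U$.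
   Context: $\mathbb N=\{0,1,2,\dots\}$, $\mathbf F=\bigcup_{k\ge1}\mathcal P(\mathbb N^k)$; $A\times B$ denotes concatenation of tuples. An equinumerosity is an equivalence relation $\approx$ on $\mathbf F$ satisfying: (E1) $A\approx B$ iff $A\setminus B\approx B\setminus A$; (E2) exactly one of $A\approx B$, $A'\approx B$ for some proper $A'\subset A$, $A\approx B'$ for some proper $B'\subset B$; (E3) $A\times\{P\}\approx\{P\}\times A\approx A$ for every point $P$; (E4) $A\approx A',B\approx B'\Rightarrow A\times B\approx A'\times B'$. Its numerosity function is $\mathfrak n(A)=[A]_\approx\in\mathfrak N=\mathbf F/\!\approx$; $\mathfrak N$ carries the sum $\mathfrak n(A)+\mathfrak n(B)=\mathfrak n(A\cup B)$ (disjoint $A,B$ of the same dimension), product $\mathfrak n(A)\mathfrak n(B)=\mathfrak n(A\times B)$, and order $\mathfrak n(A)<\mathfrak n(B)$ iff $A\approx B'$ for a proper $B'\subset B$, making it the non-negative part of a discretely ordered ring $\mathfrak R$ (the ring generated by $\mathfrak N$). For $X\subseteq\mathbb N^k$, $X_n=\{x\in X: x_i\le n \text{ for } i=1,\dots,k\}$. $\approx$ is asymptotic if (E0): whenever $|X_n|\le|Y_n|$ for all $n$, there is $Z\subseteq Y$ with $X\approx Z$. Noncommutative indeterminates $t_n$ ($n\in\mathbb N$); $t_x=t_{x_1}\cdots t_{x_k}$ for $x\in\mathbb N^k$; $S_X=\sum_{x\in X}t_x$; $\mathcal R$ is the ring of noncommutative formal power series over $\mathbb Z$ in the $t_n$ of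 bounded degree with bounded coefficients; $\mathcal R^+$ the nonzero series in $\mathcal R$ with only positive nonzero coefficients. $S(\mathbf e^n)$ is the value of $S\in\mathcal R$ when $t_j:=1$ for $j\le n$ and $t_j:=0$ for $j>n$ (so $S_X(\mathbf e^n)=|X_n|$). A nonprincipal ultrafilter $\mathcal U$ on $\mathbb N$ is quasi-selective if every $f:\mathbb N\to\mathbb N$ with $f(n)\le n$ for all $n$ agrees on a set in $\mathcal U$ with a nondecreasing function. *)

theory Defs
  imports "HOL-Algebra.RingHom" "HOL-Algebra.Subrings" "HOL-Library.Groups_Big_Fun"
begin

section \<open>Finite-dimensional point sets\<close>

text \<open>Points of \<open>\<nat>\<^sup>k\<close> are lists of length \<open>k\<close>. The empty set belongs to every dimension and is a
  single member of \<open>point_sets\<close>.\<close>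

definition tuples :: "nat \<Rightarrow> nat list set" where
  "tuples k = {x. length x = k}"

definition point_sets :: "nat list set set" where
  "point_sets = (\<Union>k\<in>{1..}. Pow (tuples k))"

definition set_concat :: "nat list set \<Rightarrow> nat list set \<Rightarrow> nat list set"  (infixl \<open>\<times>\<^sub>c\<close> 70) where
  "A \<times>\<^sub>c B = {x @ y | x y. x \<in> A \<and> y \<in> B}"

definition trunc :: "nat list set \<Rightarrow> nat \<Rightarrow> nat list set" where
  "trunc A n = {x \<in> A. \<forall>i\<in>set x. i \<le> n}"


section \<open>Equinumerosities\<close>

definition exactly_one :: "bool \<Rightarrow> bool \<Rightarrow> bool \<Rightarrow> bool" where
  "exactly_one P Q R \<longleftrightarrow> (P \<and> \<not> Q \<and> \<not> R) \<or> (\<not> P \<and> Q \<and> \<not> R) \<or> (\<not> P \<and> \<not> Q \<and> R)"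

definition equinumerosity :: "(nat list set \<times> nat list set) set \<Rightarrow> bool" where
  "equinumerosity E \<longleftrightarrow>
     equiv point_sets E \<and>
     (\<forall>A\<in>point_sets. \<forall>B\<in>point_sets. (A, B) \<in> E \<longleftrightarrow> (A - B, B - A) \<in> E) \<and>
     (\<forall>A\<in>point_sets. \<forall>B\<in>point_sets.
        exactly_one ((A, B) \<in> E) (\<exists>A'. A' \<subset> A \<and> (A', B) \<in> E) (\<exists>B'. B' \<subset> B \<and> (A, B') \<in> E)) \<and>
     (\<forall>A\<in>point_sets. \<forall>p. p \<noteq> [] \<longrightarrow> (A \<times>\<^sub>c {p}, {p} \<times>\<^sub>c A) \<in> E \<and> ({p} \<times>\<^sub>c A, A) \<in> E) \<and>
     (\<forall>A A' B B'. (A, A') \<in> E \<longrightarrow> (B, B') \<in> E \<longrightarrow> (A \<times>\<^sub>c B, A' \<times>\<^sub>c B') \<in> E)"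

definition asymptotic :: "(nat list set \<times> nat list set) set \<Rightarrow> bool" where
  "asymptotic E \<longleftrightarrow>
     (\<forall>A\<in>point_sets. \<forall>B\<in>point_sets.
        (\<forall>n. card (trunc A n) \<le> card (trunc B n)) \<longrightarrow> (\<exists>C. C \<subseteq> B \<and> (A, C) \<in> E))"


section \<open>Numerosities and the ring they generate\<close>

definition numerosity ::
    "(nat list set \<times> nat list set) set \<Rightarrow> nat list set \<Rightarrow> nat list set set" where
  "numerosity E A = E `` {A}"

definition numerosities :: "(nat list set \<times> nat list set) set \<Rightarrow> nat list set set set" where
  "numerosities E = point_sets // E"

text \<open>As usual for operations on quotients, the value is the union of the results over all choices
  of representatives; for an equinumerosity these results all coincide. Disjoint representatives of
  equal dimension always exist, because multiplying by a one-point set preserves the class.\<close>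

definition num_add ::
    "(nat list set \<times> nat list set) set \<Rightarrow> nat list set set \<Rightarrow> nat list set set \<Rightarrow> nat list set set"
  where
  "num_add E p q =
     \<Union> {numerosity E (A \<union> B) | A B. A \<in> p \<and> B \<in> q \<and> A \<inter> B = {} \<and>
          (\<exists>k\<ge>1. A \<subseteq> tuples k \<and> B \<subseteq> tuples k)}"

definition num_mult ::
    "(nat list set \<times> nat list set) set \<Rightarrow> nat list set set \<Rightarrow> nat list set set \<Rightarrow> nat list set set"
  where
  "num_mult E p q = (\<Union>A\<in>p. \<Union>B\<in>q. numerosity E (A \<times>\<^sub>c B))"

text \<open>The ring generated by the numerosities is their ring of differences: the pair \<open>(p, q)\<close> stands
  for \<open>p - q\<close>. Numerosities are cancellative under addition, so no extra summand is needed in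
  the relation below.\<close>

definition diff_rel ::
    "(nat list set \<times> nat list set) set \<Rightarrow>
     ((nat list set set \<times> nat list set set) \<times> (nat list set set \<times> nat list set set)) set" where
  "diff_rel E =
     {((p, q), (r, s)) | p q r s.
        p \<in> numerosities E \<and> q \<in> numerosities E \<and> r \<in> numerosities E \<and> s \<in> numerosities E \<and>
        num_add E p s = num_add E r q}"

type_synonym num_diff = "(nat list set set \<times> nat list set set) set"

definition num_diff ::
    "(nat list set \<times> nat list set) set \<Rightarrow> nat list set set \<Rightarrow> nat list set set \<Rightarrow> num_diff" where
  "num_diff E p q = diff_rel E `` {(p, q)}"

definition num_ring :: "(nat list set \<times> nat list set) set \<Rightarrow> num_diff ring" where
  "num_ring E =
     \<lparr>carrier = (numerosities E \<times> numerosities E) // diff_rel E,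
      mult = (\<lambda>u v. \<Union>(p, q)\<in>u. \<Union>(r, s)\<in>v.
        num_diff E (num_add E (num_mult E p r) (num_mult E q s))
                   (num_add E (num_mult E p s) (num_mult E q r))),
      one = num_diff E (numerosity E {[0]}) (numerosity E {}),
      zero = num_diff E (numerosity E {}) (numerosity E {}),
      add = (\<lambda>u v. \<Union>(p, q)\<in>u. \<Union>(r, s)\<in>v. num_diff E (num_add E p r) (num_add E q s))\<rparr>"

definition num_embed ::
    "(nat list set \<times> nat list set) set \<Rightarrow> nat list set set \<Rightarrow> num_diff" where
  "num_embed E p = num_diff E p (numerosity E {})"


section \<open>Noncommutative power series of bounded degree with bounded coefficients\<close>

text \<open>A series is its coefficient function: the list \<open>w\<close> stands for the monomial \<open>t\<^sub>w\<close>, and the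
  empty list for the monomial 1. In the product, \<open>take i w\<close> and \<open>drop i w\<close> run through all
  factorizations of the word \<open>w\<close>.\<close>

definition series_carrier :: "(nat list \<Rightarrow> int) set" where
  "series_carrier =
     {S. (\<exists>d. \<forall>w. length w > d \<longrightarrow> S w = 0) \<and> (\<exists>b. \<forall>w. \<bar>S w\<bar> \<le> b)}"

definition series_ring :: "(nat list \<Rightarrow> int) ring" where
  "series_ring =
     \<lparr>carrier = series_carrier,
      mult = (\<lambda>S T w. \<Sum>i\<le>length w. S (take i w) * T (drop i w)),
      one = (\<lambda>w. if w = [] then 1 else 0),
      zero = (\<lambda>w. 0),
      add = (\<lambda>S T w. S w + T w)\<rparr>"

definition positive_series :: "(nat list \<Rightarrow> int) set" where
  "positive_series = {S \<in> series_carrier. S \<noteq> (\<lambda>w. 0) \<and> (\<forall>w. S w \<noteq> 0 \<longrightarrow> S w > 0)}"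

definition char_series :: "nat list set \<Rightarrow> nat list \<Rightarrow> int" where
  "char_series A = (\<lambda>w. if w \<in> A then 1 else 0)"

text \<open>\<open>Sum_any\<close> sums over the words with a nonzero summand. There are finitely many of
  them if the degree of \<open>S\<close> is bounded and \<open>a\<close> has finite support.\<close>

definition series_value :: "(nat list \<Rightarrow> int) \<Rightarrow> (nat \<Rightarrow> int) \<Rightarrow> int" where
  "series_value S a = Sum_any (\<lambda>w. S w * prod_list (map a w))"

definition unit_seq :: "nat \<Rightarrow> nat \<Rightarrow> int" where
  "unit_seq n = (\<lambda>j. if j \<le> n then 1 else 0)"

definition Phi :: "(nat list \<Rightarrow> int) \<Rightarrow> nat \<Rightarrow> int" where
  "Phi S = (\<lambda>n. series_value S (unit_seq n))"


section \<open>Integer sequences\<close>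

definition seq_ring :: "(nat \<Rightarrow> int) ring" where
  "seq_ring =
     \<lparr>carrier = UNIV,
      mult = (\<lambda>f g n. f n * g n),
      one = (\<lambda>n. 1),
      zero = (\<lambda>n. 0),
      add = (\<lambda>f g n. f n + g n)\<rparr>"

definition poly_bounded :: "(nat \<Rightarrow> int) set" where
  "poly_bounded = {g. \<exists>k m. \<forall>n>m. \<bar>g n\<bar> < int n ^ k}"

definition poly_bounded_ring :: "(nat \<Rightarrow> int) ring" where
  "poly_bounded_ring = seq_ring\<lparr>carrier := poly_bounded\<rparr>"

definition numerosity_hom ::
    "(nat list set \<times> nat list set) set \<Rightarrow> ((nat \<Rightarrow> int) \<Rightarrow> num_diff) \<Rightarrow> bool" where
  "numerosity_hom E \<psi> \<longleftrightarrow>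
     ring_hom_ring poly_bounded_ring (num_ring E) \<psi> \<and>
     \<psi> ` carrier poly_bounded_ring = carrier (num_ring E) \<and>
     (\<forall>A\<in>point_sets. \<psi> (Phi (char_series A)) = num_embed E (numerosity E A))"


section \<open>Quasi-selective ultrafilters\<close>

text \<open>A set \<open>A\<close> belongs to the filter \<open>U\<close> iff \<open>eventually (\<lambda>n. n \<in> A) U\<close>.\<close>

definition ultrafilter :: "'a filter \<Rightarrow> bool" where
  "ultrafilter U \<longleftrightarrow> U \<noteq> bot \<and> (\<forall>P. eventually P U \<or> eventually (\<lambda>x. \<not> P x) U)"

definition nonprincipal :: "'a filter \<Rightarrow> bool" where
  "nonprincipal U \<longleftrightarrow> (\<forall>A. U \<noteq> principal A)"

definition quasi_selective :: "nat filter \<Rightarrow> bool" where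
  "quasi_selective U \<longleftrightarrow>
     ultrafilter U \<and> nonprincipal U \<and>
     (\<forall>f :: nat \<Rightarrow> nat. (\<forall>n. f n \<le> n) \<longrightarrow>
        (\<exists>h. mono h \<and> eventually (\<lambda>n. f n = h n) U))"

end

theory Submission
  imports Defs "HOL-Algebra.QuotRing"
begin

text \<open>
  The increments of a polynomially bounded \<open>g\<close> can be prescribed by choosing words with largest letter
  \<open>n\<close>, so \<open>g\<close> agrees with a difference \<open>|A\<^sub>n| - |B\<^sub>n|\<close> for all large \<open>n\<close>, and a power series
  supported on words of length one corrects the finitely many remaining values. For an asymptotic
  equinumerosity, moving finitely many points far out turns (E0) into a statement about eventual
  inequalities of counting functions. Hence the sequences eventually equal to \<open>|A\<^sub>n| - |B\<^sub>n|\<close> with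
  \<open>A \<approx> B\<close> form a convex ideal of \<open>\<P>\<close>, their zero sets generate an ultrafilter, and membership in the
  ideal depends only on the zero set. The ring of differences of numerosities is the quotient of \<open>\<P>\<close>
  by this ideal. Finally, a non-negative \<open>g\<close> is congruent to a difference \<open>|A\<^sub>n| - |D\<^sub>n|\<close> with \<open>D \<subseteq> A\<close>,
  which is the monotone sequence \<open>|(A - D)\<^sub>n|\<close>; this makes the ultrafilter quasi-selective.
\<close>

section \<open>Evaluation of power series\<close>

text \<open>The words of degree at most \<open>d\<close> whose monomials take the value 1 at
  \<open>unit_seq n\<close>; all other monomials of degree at most \<open>d\<close> take the value 0
  there.\<close>

definition words :: "nat \<Rightarrow> nat \<Rightarrow> nat list set" where
  "words d n = {w. set w \<subseteq> {..n} \<and> length w \<le> d}"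

lemma finite_words: "finite (words d n)"
  unfolding words_def by (rule finite_lists_length_le) simp

lemma card_words_le: "card (words d n) \<le> (d + 1) * (n + 1) ^ d"
proof -
  have "card (words d n) = (\<Sum>i\<le>d. (n + 1) ^ i)"
    unfolding words_def by (subst card_lists_length_le) auto
  also have "\<dots> \<le> (\<Sum>i\<le>d. (n + 1) ^ d)"
    by (intro sum_mono power_increasing) auto
  finally show ?thesis by simp
qed

lemma prod_list_unit_seq:
  "prod_list (map (unit_seq n) w) = (if set w \<subseteq> {..n} then 1 else 0)"
  by (induction w) (auto simp: unit_seq_def)

text \<open>The index set depends on the series only through a degree bound, so several series can
  be evaluated over the same finite set of words.\<close>

lemma Phi_eq_sum_words:
  assumes "\<And>w. length w > d \<Longrightarrow> S w = 0"
  shows "Phi S n = (\<Sum>w\<in>words d n. S w)"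
proof -
  have "{w. S w * prod_list (map (unit_seq n) w) \<noteq> 0} \<subseteq> words d n"
    using assms by (force simp: prod_list_unit_seq words_def not_less[symmetric] split: if_splits)
  then have "Phi S n = (\<Sum>w\<in>words d n. S w * prod_list (map (unit_seq n) w))"
    unfolding Phi_def series_value_def by (rule Sum_any.expand_superset[OF finite_words])
  also have "\<dots> = (\<Sum>w\<in>words d n. S w)"
    by (intro sum.cong) (auto simp: prod_list_unit_seq words_def)
  finally show ?thesis .
qed

section \<open>The ring of series of bounded degree with bounded coefficients\<close>

lemma series_carrierE:
  assumes "S \<in> series_carrier"
  obtains d b where "\<And>w. length w > d \<Longrightarrow> S w = 0" "\<And>w. \<bar>S w\<bar> \<le> b" "b \<ge> 0"
proof -
  from assms obtain d b where *: "\<And>w. length w > d \<Longrightarrow> S w = 0" "\<And>w. \<bar>S w\<bar> \<le> b"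
    by (auto simp: series_carrier_def)
  from *(2)[of "[]"] have "b \<ge> 0" by linarith
  with * show ?thesis by (rule that)
qed

lemma series_carrierI:
  assumes "\<And>w. length w > d \<Longrightarrow> S w = 0" "\<And>w. \<bar>S w\<bar> \<le> b"
  shows "S \<in> series_carrier"
  using assms unfolding series_carrier_def by blast

lemma series_carrier_add:
  assumes "S \<in> series_carrier" "T \<in> series_carrier"
  shows "(\<lambda>w. S w + T w) \<in> series_carrier"
proof -
  from assms obtain d b d' b' where
    *: "\<And>w. length w > d \<Longrightarrow> S w = 0" "\<And>w. \<bar>S w\<bar> \<le> b"
       "\<And>w. length w > d' \<Longrightarrow> T w = 0" "\<And>w. \<bar>T w\<bar> \<le> b'"
    by (metis series_carrierE)
  show ?thesis
  proof (rule series_carrierI)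
    show "S w + T w = 0" if "length w > max d d'" for w using * that by simp
    show "\<bar>S w + T w\<bar> \<le> b + b'" for w using *(2)[of w] *(4)[of w] by linarith
  qed
qed

lemma series_carrier_uminus: "S \<in> series_carrier \<Longrightarrow> (\<lambda>w. - S w) \<in> series_carrier"
  unfolding series_carrier_def by auto

text \<open>Cutting a word longer than \<open>d + e\<close> leaves a prefix longer than
  \<open>d\<close> or a suffix longer than \<open>e\<close>.\<close>

lemma conv_eq_0:
  fixes S T :: "nat list \<Rightarrow> int"
  assumes "\<And>w. length w > d \<Longrightarrow> S w = 0" "\<And>w. length w > e \<Longrightarrow> T w = 0" "length w > d + e"
  shows "(\<Sum>i\<le>length w. S (take i w) * T (drop i w)) = 0"
proof (rule sum.neutral, intro ballI)
  fix i assume "i \<in> {..length w}"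
  then have "length (take i w) > d \<or> length (drop i w) > e" using assms(3) by auto
  then show "S (take i w) * T (drop i w) = 0" using assms(1,2) by auto
qed

text \<open>Bounded degree keeps the coefficients of the product bounded: a word of length at most
  \<open>d + e\<close> has at most \<open>d + e + 1\<close> factorizations, each contributing at
  most \<open>b * b'\<close>, and longer words get the coefficient 0.\<close>

lemma series_carrier_mult:
  assumes "S \<in> series_carrier" "T \<in> series_carrier"
  shows "(\<lambda>w. \<Sum>i\<le>length w. S (take i w) * T (drop i w)) \<in> series_carrier"
proof -
  from assms obtain d b e b' where
    *: "\<And>w. length w > d \<Longrightarrow> S w = 0" "\<And>w. \<bar>S w\<bar> \<le> b" "b \<ge> 0"
       "\<And>w. length w > e \<Longrightarrow> T w = 0" "\<And>w. \<bar>T w\<bar> \<le> b'" "b' \<ge> 0"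
    by (metis series_carrierE)
  show ?thesis
  proof (rule series_carrierI)
    show "(\<Sum>i\<le>length w. S (take i w) * T (drop i w)) = 0" if "length w > d + e" for w
      using *(1,4) that by (rule conv_eq_0)
    show "\<bar>\<Sum>i\<le>length w. S (take i w) * T (drop i w)\<bar> \<le> int (d + e + 1) * (b * b')" for w
    proof (cases "length w > d + e")
      case True
      then show ?thesis using *(1,4) *(3,6) by (subst conv_eq_0) auto
    next
      case False
      have "\<bar>\<Sum>i\<le>length w. S (take i w) * T (drop i w)\<bar> \<le> (\<Sum>i\<le>length w. b * b')"
        using *(2,3,5) by (intro order.trans[OF sum_abs] sum_mono) (auto simp: abs_mult intro!: mult_mono)
      also have "\<dots> = int (length w + 1) * (b * b')" by simp
      also have "\<dots> \<le> int (d + e + 1) * (b * b')"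
        using False *(3,6) by (intro mult_right_mono) auto
      finally show ?thesis .
    qed
  qed
qed

text \<open>Both sides sum over the factorizations of \<open>w\<close> into three words; they differ
  only in which of the two cuts is made first.\<close>

lemma conv_assoc:
  fixes S T R :: "nat list \<Rightarrow> int"
  shows "(\<Sum>i\<le>length w. (\<Sum>j\<le>length (take i w). S (take j (take i w)) * T (drop j (take i w))) * R (drop i w)) =
         (\<Sum>i\<le>length w. S (take i w) * (\<Sum>j\<le>length (drop i w). T (take j (drop i w)) * R (drop j (drop i w))))"
    (is "?L = ?R")
proof -
  have "?L = (\<Sum>(i,j)\<in>Sigma {..length w} (\<lambda>i. {..i}).
                S (take j w) * T (take (i - j) (drop j w)) * R (drop i w))"
    unfolding sum_distrib_right
    by (subst sum.Sigma[symmetric]) (auto intro!: sum.cong simp: drop_take min_absorb1 min_absorb2)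
  \<comment> \<open>Two cut positions \<open>j \<le> i\<close> are re-encoded as the first cut
    \<open>j\<close> and the length \<open>i - j\<close> of the middle word.\<close>
  also have "\<dots> = (\<Sum>(i,j)\<in>Sigma {..length w} (\<lambda>i. {..length w - i}).
                S (take i w) * T (take j (drop i w)) * R (drop (j + i) w))"
    by (rule sum.reindex_bij_witness[where i = "\<lambda>(i, j). (i + j, i)" and j = "\<lambda>(i, j). (j, i - j)"])
       auto
  also have "\<dots> = ?R"
    unfolding sum_distrib_left
    by (subst sum.Sigma[symmetric]) (auto intro!: sum.cong simp: mult.assoc)
  finally show ?thesis .
qed

lemma ring_series_ring: "ring series_ring"
proof (rule ringI)
  show "abelian_group series_ring"
  proof (rule abelian_groupI)
    fix S assume "S \<in> carrier series_ring"
    then show "\<exists>T\<in>carrier series_ring. T \<oplus>\<^bsub>series_ring\<^esub> S = \<zero>\<^bsub>series_ring\<^esub>"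
      by (intro bexI[where x = "\<lambda>w. - S w"])
         (auto simp: series_ring_def fun_eq_iff series_carrier_uminus)
  qed (auto simp: series_ring_def series_carrier_add intro: series_carrierI[where d = 0 and b = 0])
  show "monoid series_ring"
  proof (rule monoidI)
    show "\<one>\<^bsub>series_ring\<^esub> \<in> carrier series_ring"
      by (auto simp: series_ring_def intro!: series_carrierI[where d = 0 and b = 1])
    fix S assume "S \<in> carrier series_ring"
    have "(\<Sum>i\<le>length w. (if take i w = [] then 1 else 0) * S (drop i w)) = (\<Sum>i\<in>{0::nat}. S w)" for w
      by (rule sum.mono_neutral_cong_right) (auto split: if_splits)
    then show "\<one>\<^bsub>series_ring\<^esub> \<otimes>\<^bsub>series_ring\<^esub> S = S"
      by (auto simp: series_ring_def)
    have "(\<Sum>i\<le>length w. S (take i w) * (if drop i w = [] then 1 else 0)) = (\<Sum>i\<in>{length w}. S w)" for w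
      by (rule sum.mono_neutral_cong_right) auto
    then show "S \<otimes>\<^bsub>series_ring\<^esub> \<one>\<^bsub>series_ring\<^esub> = S"
      by (auto simp: series_ring_def)
    fix T R
    show "S \<otimes>\<^bsub>series_ring\<^esub> T \<otimes>\<^bsub>series_ring\<^esub> R = S \<otimes>\<^bsub>series_ring\<^esub> (T \<otimes>\<^bsub>series_ring\<^esub> R)"
      unfolding series_ring_def monoid.simps by (rule ext, rule conv_assoc)
  qed (simp add: series_ring_def series_carrier_mult)
qed (auto simp: series_ring_def fun_eq_iff algebra_simps sum.distrib)

lemma cring_seq_ring: "cring seq_ring"
proof (rule cringI)
  show "abelian_group seq_ring"
  proof (rule abelian_groupI)
    fix f assume "f \<in> carrier seq_ring"
    show "\<exists>g\<in>carrier seq_ring. g \<oplus>\<^bsub>seq_ring\<^esub> f = \<zero>\<^bsub>seq_ring\<^esub>"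
      by (intro bexI[where x = "\<lambda>n. - f n"]) (auto simp: seq_ring_def)
  qed (auto simp: seq_ring_def fun_eq_iff)
  show "comm_monoid seq_ring"
    by (rule comm_monoidI) (auto simp: seq_ring_def fun_eq_iff)
qed (auto simp: seq_ring_def fun_eq_iff algebra_simps)

section \<open>Evaluation as a ring homomorphism\<close>

lemma Phi_add:
  assumes "S \<in> series_carrier" "T \<in> series_carrier"
  shows "Phi (\<lambda>w. S w + T w) n = Phi S n + Phi T n"
proof -
  from assms obtain d e where
    *: "\<And>w. length w > d \<Longrightarrow> S w = 0" "\<And>w. length w > e \<Longrightarrow> T w = 0"
    by (metis series_carrierE)
  show ?thesis
    using * by (simp add: Phi_eq_sum_words[where d = "max d e"] sum.distrib)
qed

text \<open>A word with a cut position is the same thing as a pair of words, and a concatenation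
  uses only letters up to \<open>n\<close> iff both parts do.\<close>

lemma Phi_mult:
  assumes "S \<in> series_carrier" "T \<in> series_carrier"
  shows "Phi (\<lambda>w. \<Sum>i\<le>length w. S (take i w) * T (drop i w)) n = Phi S n * Phi T n"
proof -
  from assms obtain d e where
    *: "\<And>w. length w > d \<Longrightarrow> S w = 0" "\<And>w. length w > e \<Longrightarrow> T w = 0"
    by (metis series_carrierE)
  define W where "W = {(u, v). u @ v \<in> words (d + e) n}"
  have W: "W \<subseteq> words (d + e) n \<times> words (d + e) n"
    by (auto simp: W_def words_def)
  have "Phi (\<lambda>w. \<Sum>i\<le>length w. S (take i w) * T (drop i w)) n =
        (\<Sum>w\<in>words (d + e) n. \<Sum>i\<le>length w. S (take i w) * T (drop i w))"
    using * by (intro Phi_eq_sum_words conv_eq_0)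
  also have "\<dots> = (\<Sum>(w, i)\<in>Sigma (words (d + e) n) (\<lambda>w. {..length w}). S (take i w) * T (drop i w))"
    by (rule sum.Sigma) (auto simp: finite_words)
  also have "\<dots> = (\<Sum>(u, v)\<in>W. S u * T v)"
    by (rule sum.reindex_bij_witness[where j = "\<lambda>(w, i). (take i w, drop i w)"
            and i = "\<lambda>(u, v). (u @ v, length u)"])
       (auto simp: W_def)
  \<comment> \<open>Pairs in \<open>W\<close> outside this rectangle have a component longer than
    the degree bound of its series, so their products vanish.\<close>
  also have "\<dots> = (\<Sum>(u, v)\<in>words d n \<times> words e n. S u * T v)"
  proof (rule sum.mono_neutral_right)
    show "finite W" using W by (rule finite_subset) (simp add: finite_words)
    show "words d n \<times> words e n \<subseteq> W" by (auto simp: W_def words_def)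
    show "\<forall>i\<in>W - words d n \<times> words e n. (case i of (u, v) \<Rightarrow> S u * T v) = 0"
      using * by (auto simp: W_def words_def) (meson not_le)+
  qed
  also have "\<dots> = Phi S n * Phi T n"
    using * by (simp add: Phi_eq_sum_words[where d = d] Phi_eq_sum_words[where d = e]
        sum_product sum.cartesian_product)
  finally show ?thesis .
qed

lemma ring_hom_ring_Phi: "ring_hom_ring series_ring seq_ring Phi"
proof (rule ring_hom_ringI)
  show "ring seq_ring" using cring_seq_ring by (rule cring.axioms)
  have "words 0 n = {[]}" for n by (auto simp: words_def)
  then have "Phi (\<lambda>w. if w = [] then 1 else 0) n = 1" for n
    by (subst Phi_eq_sum_words[where d = 0]) auto
  then show "Phi \<one>\<^bsub>series_ring\<^esub> = \<one>\<^bsub>seq_ring\<^esub>"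
    by (simp add: series_ring_def seq_ring_def fun_eq_iff)
qed (rule ring_series_ring, auto simp: series_ring_def seq_ring_def fun_eq_iff Phi_add Phi_mult)

text \<open>Once \<open>n\<close> bounds the letters of some word with nonzero coefficient, the
  value at \<open>n\<close> is a sum of non-negative terms with a positive one among them.\<close>

lemma Phi_positive_series:
  assumes "S \<in> positive_series"
  shows "Phi S \<noteq> (\<lambda>n. 0)"
proof -
  have S: "S \<in> series_carrier" and nz: "S \<noteq> (\<lambda>w. 0)" and pos: "\<And>w. S w \<noteq> 0 \<Longrightarrow> S w > 0"
    using assms by (auto simp: positive_series_def)
  from S obtain d where d: "\<And>w. length w > d \<Longrightarrow> S w = 0"
    by (metis series_carrierE)
  from nz obtain w where w: "S w \<noteq> 0" by auto
  \<comment> \<open>The sum of the letters is an upper bound for each of them.\<close>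
  define n where "n = sum_list w"
  have "w \<in> words d n"
    using w d by (force simp: words_def n_def not_less[symmetric] dest: member_le_sum_list)
  moreover have "S v \<ge> 0" for v
    using pos[of v] by linarith
  ultimately have "0 < (\<Sum>w\<in>words d n. S w)"
    using pos[OF w] by (intro sum_pos2[OF finite_words])
  then have "Phi S n > 0" using Phi_eq_sum_words[of d S n, OF d] by simp
  then show ?thesis by auto
qed


section \<open>Polynomially bounded sequences and counting functions\<close>

text \<open>The form with a constant and base \<open>n + 1\<close> holds at every index, so bounds
  can be added and multiplied without adjusting thresholds.\<close>

lemma poly_bounded_iff: "g \<in> poly_bounded \<longleftrightarrow> (\<exists>C k. \<forall>n. \<bar>g n\<bar> \<le> C * (int n + 1) ^ k)"
proof
  assume "g \<in> poly_bounded"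
  then obtain k m where km: "\<And>n. n > m \<Longrightarrow> \<bar>g n\<bar> < int n ^ k"
    by (auto simp: poly_bounded_def)
  \<comment> \<open>The finitely many values up to the threshold are absorbed in the
    constant.\<close>
  define C where "C = 1 + (\<Sum>n\<le>m. \<bar>g n\<bar>)"
  have C: "C \<ge> 1" unfolding C_def by (simp add: sum_nonneg)
  have "\<bar>g n\<bar> \<le> C * (int n + 1) ^ k" for n
  proof (cases "n > m")
    case True
    have "int n ^ k \<le> (int n + 1) ^ k" by (intro power_mono) auto
    also have "\<dots> \<le> C * (int n + 1) ^ k" using C mult_right_mono[of 1 C "(int n + 1) ^ k"] by simp
    finally show ?thesis using km[OF True] by linarith
  next
    case False
    then have "\<bar>g n\<bar> \<le> (\<Sum>n\<le>m. \<bar>g n\<bar>)" by (intro member_le_sum) auto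
    then have "\<bar>g n\<bar> \<le> C" unfolding C_def by linarith
    also have "C \<le> C * (int n + 1) ^ k"
      using C mult_left_mono[of 1 "(int n + 1) ^ k" C] by (simp add: one_le_power)
    finally show ?thesis .
  qed
  then show "\<exists>C k. \<forall>n. \<bar>g n\<bar> \<le> C * (int n + 1) ^ k" by blast
next
  assume "\<exists>C k. \<forall>n. \<bar>g n\<bar> \<le> C * (int n + 1) ^ k"
  then obtain C k where Ck: "\<And>n. \<bar>g n\<bar> \<le> C * (int n + 1) ^ k" by blast
  have "C * 1 ^ k \<ge> 0" using Ck[of 0] by simp
  then have C: "C \<ge> 0" by simp
  \<comment> \<open>Beyond this threshold both \<open>C < n\<close> and
    \<open>n + 1 \<le> n ^ 2\<close> hold, so the bound stays below
    \<open>n * (n ^ 2) ^ k\<close>.\<close>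
  have "\<bar>g n\<bar> < int n ^ (2 * k + 1)" if "n > max (nat C) 1" for n
  proof -
    have n: "int n > C" "int n \<ge> 2" using that by linarith+
    have "2 * int n \<le> int n * int n" using n by (intro mult_right_mono) auto
    then have "int n + 1 \<le> int n ^ 2" using n unfolding power2_eq_square by linarith
    then have "(int n + 1) ^ k \<le> (int n ^ 2) ^ k" by (intro power_mono) auto
    then have "C * (int n + 1) ^ k \<le> C * (int n ^ 2) ^ k" using C by (intro mult_left_mono)
    also have "\<dots> < int n * (int n ^ 2) ^ k" using n by (intro mult_strict_right_mono) auto
    finally show ?thesis using Ck[of n] by (simp add: power_mult)
  qed
  then show "g \<in> poly_bounded" unfolding poly_bounded_def by blast
qed

lemma poly_bounded_add:
  assumes "f \<in> poly_bounded" "g \<in> poly_bounded"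
  shows "(\<lambda>n. f n + g n) \<in> poly_bounded"
proof -
  from assms obtain C k D l where *: "\<And>n. \<bar>f n\<bar> \<le> C * (int n + 1) ^ k" "\<And>n. \<bar>g n\<bar> \<le> D * (int n + 1) ^ l"
    unfolding poly_bounded_iff by metis
  from *(1)[of 0] *(2)[of 0] have CD: "C \<ge> 0" "D \<ge> 0" by simp_all
  have "\<bar>f n + g n\<bar> \<le> (C + D) * (int n + 1) ^ (k + l)" for n
  proof -
    have "\<bar>f n\<bar> \<le> C * (int n + 1) ^ (k + l)"
      by (rule order.trans[OF *(1)]) (intro mult_left_mono power_increasing, use CD in auto)
    moreover have "\<bar>g n\<bar> \<le> D * (int n + 1) ^ (k + l)"
      by (rule order.trans[OF *(2)]) (intro mult_left_mono power_increasing, use CD in auto)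
    ultimately show ?thesis by (simp add: distrib_right)
  qed
  then show ?thesis unfolding poly_bounded_iff by blast
qed

lemma poly_bounded_mult:
  assumes "f \<in> poly_bounded" "g \<in> poly_bounded"
  shows "(\<lambda>n. f n * g n) \<in> poly_bounded"
proof -
  from assms obtain C k D l where *: "\<And>n. \<bar>f n\<bar> \<le> C * (int n + 1) ^ k" "\<And>n. \<bar>g n\<bar> \<le> D * (int n + 1) ^ l"
    unfolding poly_bounded_iff by metis
  have "\<bar>f n * g n\<bar> \<le> (C * D) * (int n + 1) ^ (k + l)" for n
    using mult_mono[OF *(1)[of n] *(2)[of n]] order.trans[OF _ *(1)[of n], of 0]
    by (simp add: abs_mult power_add mult_ac)
  then show ?thesis unfolding poly_bounded_iff by blast
qed

lemma poly_bounded_dominated: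
  assumes "g \<in> poly_bounded" "\<And>n. \<bar>f n\<bar> \<le> \<bar>g n\<bar>"
  shows "f \<in> poly_bounded"
  using assms unfolding poly_bounded_iff by (meson order.trans)

lemma poly_bounded_const: "(\<lambda>n. c) \<in> poly_bounded"
  unfolding poly_bounded_iff by (intro exI[of _ "\<bar>c\<bar>"] exI[of _ 0]) auto

lemma poly_bounded_uminus: "f \<in> poly_bounded \<Longrightarrow> (\<lambda>n. - f n) \<in> poly_bounded"
  by (rule poly_bounded_dominated) auto

lemma poly_bounded_diff:
  "f \<in> poly_bounded \<Longrightarrow> g \<in> poly_bounded \<Longrightarrow> (\<lambda>n. f n - g n) \<in> poly_bounded"
  using poly_bounded_add[of f "\<lambda>n. - g n"] poly_bounded_uminus by simp

lemma subring_poly_bounded: "subring poly_bounded seq_ring"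
proof -
  interpret cring seq_ring by (rule cring_seq_ring)
  show ?thesis
  proof (rule subringI)
    fix f assume f: "f \<in> poly_bounded"
    have "\<ominus>\<^bsub>seq_ring\<^esub> f = (\<lambda>n. - f n)"
      by (rule minus_equality) (auto simp: seq_ring_def)
    with f show "\<ominus>\<^bsub>seq_ring\<^esub> f \<in> poly_bounded" by (simp add: poly_bounded_uminus)
  qed (auto simp: seq_ring_def poly_bounded_add poly_bounded_mult poly_bounded_const)
qed

lemma cring_poly_bounded_ring: "cring poly_bounded_ring"
proof -
  interpret cring seq_ring by (rule cring_seq_ring)
  show ?thesis
    unfolding poly_bounded_ring_def
    using subring_poly_bounded by (intro subcring_iff[THEN iffD1] subcringI')
      (auto dest: subringE)
qed

lemma Phi_poly_bounded:
  assumes "S \<in> series_carrier"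
  shows "Phi S \<in> poly_bounded"
proof -
  from assms obtain d b where *: "\<And>w. length w > d \<Longrightarrow> S w = 0" "\<And>w. \<bar>S w\<bar> \<le> b" "b \<ge> 0"
    by (metis series_carrierE)
  have "\<bar>Phi S n\<bar> \<le> (int (d + 1) * b) * (int n + 1) ^ d" for n
  proof -
    have "\<bar>Phi S n\<bar> \<le> (\<Sum>w\<in>words d n. b)"
      using * by (subst Phi_eq_sum_words) (auto simp del: sum_constant intro!: order.trans[OF sum_abs] sum_mono)
    also have "\<dots> = int (card (words d n)) * b" by simp
    also have "\<dots> \<le> int ((d + 1) * (n + 1) ^ d) * b"
      using card_words_le *(3) by (intro mult_right_mono) (simp_all only: of_nat_le_iff)
    finally show ?thesis by (simp add: algebra_simps)
  qed
  then show ?thesis unfolding poly_bounded_iff by blast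
qed

section \<open>Counting functions of point sets\<close>

definition cnt :: "nat list set \<Rightarrow> nat \<Rightarrow> int" where
  "cnt A n = int (card (trunc A n))"

lemma point_setsI: "k \<ge> 1 \<Longrightarrow> A \<subseteq> tuples k \<Longrightarrow> A \<in> point_sets"
  by (auto simp: point_sets_def)

lemma point_setsE:
  assumes "A \<in> point_sets"
  obtains k where "k \<ge> 1" "A \<subseteq> tuples k"
  using assms by (auto simp: point_sets_def)

lemma finite_trunc:
  assumes "A \<in> point_sets"
  shows "finite (trunc A n)"
proof -
  from assms obtain k where "A \<subseteq> tuples k" by (rule point_setsE)
  then have "trunc A n \<subseteq> words k n" by (auto simp: trunc_def words_def tuples_def)
  then show ?thesis using finite_words by (rule finite_subset)
qed

lemma char_series_carrier:
  assumes "A \<in> point_sets"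
  shows "char_series A \<in> series_carrier"
proof -
  from assms obtain k where "A \<subseteq> tuples k" by (rule point_setsE)
  then show ?thesis
    by (intro series_carrierI[where d = k and b = 1]) (auto simp: char_series_def tuples_def)
qed

lemma Phi_char_series:
  assumes "A \<in> point_sets"
  shows "Phi (char_series A) = cnt A"
proof
  fix n
  from assms obtain k where k: "A \<subseteq> tuples k" by (rule point_setsE)
  have "Phi (char_series A) n = (\<Sum>w\<in>words k n. char_series A w)"
    using k by (intro Phi_eq_sum_words) (auto simp: char_series_def tuples_def)
  also have "\<dots> = int (card (words k n \<inter> A))"
    by (simp add: char_series_def sum.If_cases finite_words)
  also have "words k n \<inter> A = trunc A n"
    using k by (auto simp: trunc_def words_def tuples_def)
  finally show "Phi (char_series A) n = cnt A n" by (simp add: cnt_def)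
qed

lemma cnt_poly_bounded: "A \<in> point_sets \<Longrightarrow> cnt A \<in> poly_bounded"
  using Phi_poly_bounded[OF char_series_carrier] by (simp add: Phi_char_series)

text \<open>There are \<open>(n + 1) ^ k\<close> words \<open>n # v\<close> of length \<open>k + 1\<close> with largest letter \<open>n\<close>,
  which leaves room to prescribe the increments of the counting function.\<close>

lemma ex_set_with_increments:
  fixes h :: "nat \<Rightarrow> nat"
  assumes h: "\<And>n. h n \<le> (n + 1) ^ k"
  shows "\<exists>A \<subseteq> tuples (k + 1). \<forall>n. card (trunc A n) = (\<Sum>j\<le>n. h j)"
proof -
  define B where "B n = (#) n ` {v. set v \<subseteq> {..n} \<and> length v = k}" for n :: nat
  have "card (B n) = (n + 1) ^ k" for n
    unfolding B_def by (subst card_image) (auto simp: card_lists_length_eq)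
  then have "\<exists>W. W \<subseteq> B n \<and> card W = h n \<and> finite W" for n
    using h[of n] obtain_subset_with_card_n[of "h n" "B n"] by metis
  then obtain W where W: "\<And>n. W n \<subseteq> B n" "\<And>n. card (W n) = h n" "\<And>n. finite (W n)"
    by metis
  \<comment> \<open>The first letter tells the sets \<open>W n\<close> apart; being also the largest
    letter, it is the index from which on the word is counted.\<close>
  have hd: "hd w = n" and set: "set w \<subseteq> {..n}" and ne: "n \<in> set w" if "w \<in> W n" for w n
    using that W(1)[of n] unfolding B_def by fastforce+
  have "(\<Union>n. W n) \<subseteq> tuples (k + 1)"
    using W(1) unfolding B_def tuples_def by fastforce
  moreover have "card (trunc (\<Union>n. W n) n) = (\<Sum>j\<le>n. h j)" for n
  proof -
    have "trunc (\<Union>n. W n) n = (\<Union>j\<le>n. W j)"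
      unfolding trunc_def using set ne by fastforce
    also have "card \<dots> = (\<Sum>j\<le>n. card (W j))"
      using W(3) hd by (intro card_UN_disjoint) (auto, metis)
    finally show ?thesis by (simp add: W(2))
  qed
  ultimately show ?thesis by blast
qed

text \<open>Telescoping that starts at \<open>m\<close>: the whole value \<open>g m\<close> enters
  as one jump, and the earlier values of \<open>g\<close> are forgotten.\<close>

lemma sum_jumps:
  fixes g :: "nat \<Rightarrow> int"
  shows "n \<ge> m \<Longrightarrow> (\<Sum>j\<le>n. if j < m then 0 else if j = m then g m else g j - g (j - 1)) = g n"
proof (induction n rule: dec_induct)
  case base
  have "(\<Sum>j\<le>m. if j < m then 0 else if j = m then g m else g j - g (j - 1)) = (\<Sum>j\<in>{m}. g m)"
    by (rule sum.mono_neutral_cong_right) auto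
  then show ?case by simp
qed simp

text \<open>The positive and the negative parts of the increments of \<open>g\<close> both grow
  slowly enough to be the increments of counting functions. The values below \<open>m\<close> are
  discarded, so equality is reached only from \<open>m\<close> on.\<close>

lemma poly_bounded_eventually_cnt_diff:
  assumes "g \<in> poly_bounded"
  shows "\<exists>A\<in>point_sets. \<exists>B\<in>point_sets. \<forall>\<^sub>F n in sequentially. g n = cnt A n - cnt B n"
proof -
  from assms obtain k m0 where km: "\<And>n. n > m0 \<Longrightarrow> \<bar>g n\<bar> < int n ^ k"
    by (auto simp: poly_bounded_def)
  \<comment> \<open>From \<open>m\<close> on the bound on \<open>g\<close> applies. Since also
    \<open>m \<ge> 1\<close>, the factor 2 coming from the two terms of an increment is at most
    \<open>j + 1\<close> and is absorbed by one more power.\<close>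
  define m where "m = Suc m0"
  define d where "d j = (if j < m then 0 else if j = m then g m else g j - g (j - 1))" for j
  have bound: "\<bar>d j\<bar> \<le> int ((j + 1) ^ (k + 1))" for j
  proof -
    have mono: "int i ^ k \<le> (int j + 1) ^ k" if "i \<le> j" for i using that by (intro power_mono) auto
    have pos: "(int j + 1) ^ k \<ge> 0" by simp
    have "\<bar>d j\<bar> \<le> 2 * (int j + 1) ^ k" if "j > m"
    proof -
      have "\<bar>g j\<bar> < int j ^ k" "\<bar>g (j - 1)\<bar> < int (j - 1) ^ k"
        using that by (auto intro!: km simp: m_def simp del: of_nat_diff)
      then show ?thesis
        using that mono[of j] mono[of "j - 1"] by (simp add: d_def del: of_nat_diff)
    qed
    moreover have "2 * (int j + 1) ^ k \<le> (int j + 1) * (int j + 1) ^ k" if "j \<ge> m"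
      using that by (intro mult_right_mono) (auto simp: m_def)
    moreover have "\<bar>d j\<bar> \<le> 2 * (int j + 1) ^ k" if "j = m"
      using that km[of j] mono[of j] pos by (simp add: d_def m_def)
    moreover have "\<bar>d j\<bar> = 0" if "j < m" using that by (simp add: d_def)
    moreover have "0 \<le> (int j + 1) * (int j + 1) ^ k" by simp
    ultimately have "\<bar>d j\<bar> \<le> (int j + 1) * (int j + 1) ^ k"
      by (cases j m rule: linorder_cases) linarith+
    then show ?thesis by (simp add: algebra_simps)
  qed
  have "nat (d j) \<le> (j + 1) ^ (k + 1)" "nat (- d j) \<le> (j + 1) ^ (k + 1)" for j
    using bound[of j] by linarith+
  then obtain A B where
    AB: "A \<subseteq> tuples (k + 1 + 1)" "\<And>n. card (trunc A n) = (\<Sum>j\<le>n. nat (d j))"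
        "B \<subseteq> tuples (k + 1 + 1)" "\<And>n. card (trunc B n) = (\<Sum>j\<le>n. nat (- d j))"
    using ex_set_with_increments[of "\<lambda>j. nat (d j)" "k + 1"]
      ex_set_with_increments[of "\<lambda>j. nat (- d j)" "k + 1"] by metis
  have "g n = cnt A n - cnt B n" if "n \<ge> m" for n
  proof -
    have "cnt A n - cnt B n = (\<Sum>j\<le>n. int (nat (d j)) - int (nat (- d j)))"
      by (simp add: cnt_def AB sum_subtractf)
    also have "\<dots> = (\<Sum>j\<le>n. d j)" by (intro sum.cong) auto
    also have "\<dots> = g n" using sum_jumps[OF that, of g] by (simp add: d_def)
    finally show ?thesis by simp
  qed
  then show ?thesis
    using AB(1,3) by (intro bexI[of _ A] bexI[of _ B] eventually_sequentiallyI point_setsI) auto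
qed

text \<open>A series of degree one whose coefficients are the increments of \<open>e\<close> has the
  values of \<open>e\<close>. The coefficients are bounded because only finitely many increments
  differ from 0.\<close>

lemma Phi_range_eventually_0:
  assumes "\<forall>\<^sub>F n in sequentially. e n = 0"
  shows "\<exists>S\<in>series_carrier. Phi S = e"
proof -
  from assms obtain m where m: "\<And>n. n \<ge> m \<Longrightarrow> e n = 0" by (auto simp: eventually_sequentially)
  \<comment> \<open>At 0 the increment is the initial value; truncated subtraction
    \<open>0 - 1 = 0\<close> would lose it.\<close>
  define d where "d j = (if j = 0 then e 0 else e j - e (j - 1))" for j
  define S where "S w = (case w of [j] \<Rightarrow> d j | _ \<Rightarrow> 0)" for w :: "nat list"
  have d0: "d j = 0" if "j > m" for j using that m by (simp add: d_def)
  have le: "\<bar>d j\<bar> \<le> (\<Sum>j\<le>m. \<bar>d j\<bar>)" for j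
    using d0[of j] by (cases "j > m") (auto simp: sum_nonneg intro!: member_le_sum)
  have S: "S \<in> series_carrier"
  proof (rule series_carrierI)
    show "S w = 0" if "length w > 1" for w
      using that by (auto simp: S_def split: list.splits)
    show "\<bar>S w\<bar> \<le> (\<Sum>j\<le>m. \<bar>d j\<bar>)" for w
      using le by (auto simp: S_def sum_nonneg split: list.splits)
  qed
  have "Phi S n = e n" for n
  proof -
    have "Phi S n = (\<Sum>w\<in>words 1 n. S w)"
      by (rule Phi_eq_sum_words) (auto simp: S_def split: list.splits)
    also have "words 1 n = insert [] ((\<lambda>j. [j]) ` {..n})"
      by (auto simp: words_def le_Suc_eq length_Suc_conv)
    also have "(\<Sum>w\<in>\<dots>. S w) = (\<Sum>w\<in>(\<lambda>j. [j]) ` {..n}. S w)"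
      by (subst sum.insert) (auto simp: S_def)
    also have "\<dots> = (\<Sum>j\<le>n. d j)"
      by (subst sum.reindex) (auto simp: S_def inj_on_def)
    also have "\<dots> = e n"
      by (induction n) (auto simp: d_def)
    finally show ?thesis .
  qed
  then show ?thesis using S by blast
qed

text \<open>Counting functions are values of characteristic series, so only the eventually vanishing
  error between \<open>g\<close> and \<open>cnt A - cnt B\<close> remains to be realised.\<close>

lemma Phi_range: "Phi ` series_carrier = poly_bounded"
proof
  show "Phi ` series_carrier \<subseteq> poly_bounded" using Phi_poly_bounded by blast
  show "poly_bounded \<subseteq> Phi ` series_carrier"
  proof
    fix g assume "g \<in> poly_bounded"
    then obtain A B where AB: "A \<in> point_sets" "B \<in> point_sets"
        and ev: "\<forall>\<^sub>F n in sequentially. g n = cnt A n - cnt B n"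
      using poly_bounded_eventually_cnt_diff by blast
    from ev have "\<forall>\<^sub>F n in sequentially. g n - cnt A n + cnt B n = 0"
      by eventually_elim simp
    then obtain S where S: "S \<in> series_carrier" "Phi S = (\<lambda>n. g n - cnt A n + cnt B n)"
      using Phi_range_eventually_0[of "\<lambda>n. g n - cnt A n + cnt B n"] by blast
    define T where "T w = (char_series A w + S w)" for w
    have T: "T \<in> series_carrier" "Phi T = (\<lambda>n. g n + cnt B n)"
      using S AB by (auto simp: T_def[abs_def] series_carrier_add char_series_carrier Phi_add Phi_char_series fun_eq_iff)
    define B' where "B' w = - char_series B w" for w
    have B': "B' \<in> series_carrier"
      using char_series_carrier[OF AB(2)] by (simp add: B'_def[abs_def] series_carrier_uminus)
    have "Phi (\<lambda>w. char_series B w + B' w) n = 0" for n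
      by (simp add: B'_def Phi_def series_value_def)
    then have "Phi B' n = - cnt B n" for n
      using Phi_add[OF char_series_carrier[OF AB(2)] B', of n] by (simp add: Phi_char_series AB)
    then have "Phi (\<lambda>w. T w + B' w) = g"
      using Phi_add[OF T(1) B'] T(2) by (auto simp: fun_eq_iff)
    then show "g \<in> Phi ` series_carrier"
      using series_carrier_add[OF T(1) B'] by blast
  qed
qed


section \<open>Asymptotic equinumerosities\<close>

lemma point_sets_subset: "A \<in> point_sets \<Longrightarrow> B \<subseteq> A \<Longrightarrow> B \<in> point_sets"
  by (auto simp: point_sets_def)

lemma empty_point_sets: "{} \<in> point_sets"
  by (auto simp: point_sets_def)

lemma singleton_point_sets: "p \<noteq> [] \<Longrightarrow> {p} \<in> point_sets"
  by (rule point_setsI[of "length p"]) (auto simp: tuples_def Suc_le_eq)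

lemma set_concat_tuples: "A \<subseteq> tuples k \<Longrightarrow> B \<subseteq> tuples l \<Longrightarrow> A \<times>\<^sub>c B \<subseteq> tuples (k + l)"
  unfolding set_concat_def tuples_def by fastforce

lemma set_concat_point_sets:
  assumes "A \<in> point_sets" "B \<in> point_sets"
  shows "A \<times>\<^sub>c B \<in> point_sets"
proof -
  from assms obtain k l where "k \<ge> 1" "A \<subseteq> tuples k" "B \<subseteq> tuples l" by (metis point_setsE)
  then show ?thesis by (intro point_setsI[of "k + l"] set_concat_tuples) auto
qed

lemma Un_set_concat: "(A \<union> B) \<times>\<^sub>c C = A \<times>\<^sub>c C \<union> B \<times>\<^sub>c C"
  by (auto simp: set_concat_def)

text \<open>The last letters tell the two copies apart, whatever \<open>A\<close> and
  \<open>B\<close> are. This is the source of disjoint representatives.\<close>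

lemma set_concat_disjoint:
  assumes "last p \<noteq> last q" "p \<noteq> []" "q \<noteq> []"
  shows "(A \<times>\<^sub>c {p}) \<inter> (B \<times>\<^sub>c {q}) = {}"
proof -
  have "x @ p \<noteq> y @ q" for x y
    using assms by (metis last_appendR)
  then show ?thesis by (auto simp: set_concat_def)
qed

lemma set_concat_singleton_Int: "(A \<times>\<^sub>c {p}) \<inter> (B \<times>\<^sub>c {p}) = (A \<inter> B) \<times>\<^sub>c {p}"
  by (auto simp: set_concat_def)

lemma cnt_Un_disjoint:
  assumes "A \<in> point_sets" "B \<in> point_sets" "A \<inter> B = {}"
  shows "cnt (A \<union> B) n = cnt A n + cnt B n"
proof -
  have "trunc (A \<union> B) n = trunc A n \<union> trunc B n" by (auto simp: trunc_def)
  moreover have "trunc A n \<inter> trunc B n = {}" using assms by (auto simp: trunc_def)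
  ultimately show ?thesis
    using assms by (simp add: cnt_def card_Un_disjoint finite_trunc)
qed

text \<open>All words in \<open>A\<close> have the same length, so a concatenation determines its
  two parts.\<close>

lemma cnt_set_concat:
  assumes "A \<in> point_sets"
  shows "cnt (A \<times>\<^sub>c B) n = cnt A n * cnt B n"
proof -
  from assms obtain k where k: "A \<subseteq> tuples k" by (rule point_setsE)
  have "trunc (A \<times>\<^sub>c B) n = (\<lambda>(x, y). x @ y) ` (trunc A n \<times> trunc B n)"
    unfolding trunc_def set_concat_def by fastforce
  moreover have "inj_on (\<lambda>(x, y). x @ y) (trunc A n \<times> trunc B n)"
    using k unfolding inj_on_def trunc_def tuples_def by (auto; metis (mono_tags) append_eq_append_conv mem_Collect_eq subsetD)
  ultimately show ?thesis
    by (simp add: cnt_def card_image card_cartesian_product)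
qed

lemma cnt_empty [simp]: "cnt {} n = 0"
  by (simp add: cnt_def trunc_def)

lemma cnt_singleton: "cnt {p} n = (if set p \<subseteq> {..n} then 1 else 0)"
proof -
  have "trunc {p} n = (if set p \<subseteq> {..n} then {p} else {})" by (auto simp: trunc_def)
  then show ?thesis by (simp add: cnt_def)
qed

lemma eventually_cnt_singleton: "\<forall>\<^sub>F n in sequentially. cnt {p} n = 1"
  using eventually_ge_at_top[of "sum_list p"]
  by eventually_elim (auto simp: cnt_singleton dest: member_le_sum_list)

text \<open>Evaluates the operations of \<open>num_ring\<close>, which are unions over all
  representatives: both classes are nonempty and every choice gives the same result.\<close>

lemma UN_pairs_constant:
  assumes "\<And>p q r s. (p, q) \<in> U \<Longrightarrow> (r, s) \<in> V \<Longrightarrow> F p q r s = C" "u \<in> U" "v \<in> V"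
  shows "(\<Union>(p, q)\<in>U. \<Union>(r, s)\<in>V. F p q r s) = C"
proof -
  have "(\<Union>(p, q)\<in>U. \<Union>(r, s)\<in>V. F p q r s) = (\<Union>_\<in>U. \<Union>_\<in>V. C)"
    using assms(1) by (intro SUP_cong refl) (auto intro!: SUP_cong)
  then show ?thesis using assms(2,3) by auto
qed

section \<open>Consequences of the axioms of an equinumerosity\<close>

locale asymptotic_equinumerosity =
  fixes E :: "(nat list set \<times> nat list set) set"
  assumes equinumerosity: "equinumerosity E" and asymptotic: "asymptotic E"
begin

abbreviation eqn :: "nat list set \<Rightarrow> nat list set \<Rightarrow> bool"  (infix \<open>\<approx>\<close> 50) where
  "A \<approx> B \<equiv> (A, B) \<in> E"

text \<open>The order of numerosities, read on representatives.\<close>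

definition less_num :: "nat list set \<Rightarrow> nat list set \<Rightarrow> bool"  (infix \<open>\<prec>\<close> 50) where
  "A \<prec> B \<longleftrightarrow> (\<exists>C. C \<subset> B \<and> A \<approx> C)"

lemma equiv: "equiv point_sets E"
  using equinumerosity by (simp add: equinumerosity_def)

lemma eqn_point_sets: "A \<approx> B \<Longrightarrow> A \<in> point_sets \<and> B \<in> point_sets"
  using equiv by (auto simp: equiv_def)

lemma eqn_refl: "A \<in> point_sets \<Longrightarrow> A \<approx> A"
  using equiv by (auto simp: equiv_def refl_on_def)

lemma eqn_sym: "A \<approx> B \<Longrightarrow> B \<approx> A"
  using equiv by (auto simp: equiv_def dest: symD)

lemma eqn_trans [trans]: "A \<approx> B \<Longrightarrow> B \<approx> C \<Longrightarrow> A \<approx> C"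
  using equiv by (auto simp: equiv_def dest: transD)

lemma eqn_diff_iff: "A \<in> point_sets \<Longrightarrow> B \<in> point_sets \<Longrightarrow> A \<approx> B \<longleftrightarrow> A - B \<approx> B - A"
  using equinumerosity by (simp add: equinumerosity_def)

text \<open>Axiom (E2) with its second alternative turned around by the symmetry of
  \<open>\<approx>\<close>.\<close>

lemma trichotomy:
  assumes "A \<in> point_sets" "B \<in> point_sets"
  shows "exactly_one (A \<approx> B) (B \<prec> A) (A \<prec> B)"
proof -
  have "(\<exists>A'. A' \<subset> A \<and> A' \<approx> B) \<longleftrightarrow> B \<prec> A"
    using eqn_sym by (auto simp: less_num_def)
  moreover have "exactly_one (A \<approx> B) (\<exists>A'. A' \<subset> A \<and> A' \<approx> B) (\<exists>B'. B' \<subset> B \<and> A \<approx> B')"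
    using equinumerosity assms unfolding equinumerosity_def by blast
  ultimately show ?thesis by (simp add: less_num_def)
qed

lemma singleton_eqn_left: "A \<in> point_sets \<Longrightarrow> p \<noteq> [] \<Longrightarrow> {p} \<times>\<^sub>c A \<approx> A"
  and eqn_singleton_swap: "A \<in> point_sets \<Longrightarrow> p \<noteq> [] \<Longrightarrow> A \<times>\<^sub>c {p} \<approx> {p} \<times>\<^sub>c A"
  using equinumerosity by (simp_all add: equinumerosity_def)

text \<open>Padding changes the dimension of a set but not its class, which gives access to common
  dimensions and disjoint copies.\<close>

lemma eqn_pad: "A \<in> point_sets \<Longrightarrow> p \<noteq> [] \<Longrightarrow> A \<times>\<^sub>c {p} \<approx> A"
  by (rule eqn_trans[OF eqn_singleton_swap singleton_eqn_left])

lemma eqn_set_concat: "A \<approx> A' \<Longrightarrow> B \<approx> B' \<Longrightarrow> A \<times>\<^sub>c B \<approx> A' \<times>\<^sub>c B'"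
  using equinumerosity by (simp add: equinumerosity_def)

lemma less_num_cong:
  assumes "A \<approx> A'" "B \<approx> B'"
  shows "A \<prec> B \<longleftrightarrow> A' \<prec> B'"
proof -
  have left: "Y \<prec> Z" if "X \<prec> Z" "X \<approx> Y" for X Y Z
    using that eqn_trans[OF eqn_sym[OF that(2)]] unfolding less_num_def by auto
  \<comment> \<open>No proper subset of \<open>Z\<close> is constructed: the other two alternatives
    for \<open>X\<close> and \<open>Z\<close> would carry over to \<open>X\<close> and
    \<open>Y\<close>, where trichotomy forbids them.\<close>
  have right: "X \<prec> Z" if "X \<prec> Y" "Y \<approx> Z" for X Y Z
  proof -
    have ps: "X \<in> point_sets" "Y \<in> point_sets" "Z \<in> point_sets"
      using that eqn_point_sets unfolding less_num_def by auto
    have "\<not> X \<approx> Y" "\<not> Y \<prec> X"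
      using trichotomy[of X Y] ps that(1) by (auto simp: exactly_one_def)
    then have "\<not> X \<approx> Z" "\<not> Z \<prec> X"
      using eqn_trans[OF _ eqn_sym[OF that(2)]] left[OF _ eqn_sym[OF that(2)]] by auto
    then show ?thesis using trichotomy[of X Z] ps by (auto simp: exactly_one_def)
  qed
  show ?thesis
    using left[OF right[OF _ assms(2)] assms(1)] left[OF right[OF _ eqn_sym[OF assms(2)]] eqn_sym[OF assms(1)]]
    by auto
qed

text \<open>Axiom (E1) sees only the two differences, and a common part disjoint from both sets
  leaves these unchanged.\<close>

lemma eqn_Un_right_iff:
  assumes "A \<union> C \<in> point_sets" "B \<union> C \<in> point_sets" "A \<inter> C = {}" "B \<inter> C = {}"
  shows "A \<union> C \<approx> B \<union> C \<longleftrightarrow> A \<approx> B"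
proof -
  have "A \<in> point_sets" "B \<in> point_sets" using assms point_sets_subset by blast+
  moreover have "(A \<union> C) - (B \<union> C) = A - B" "(B \<union> C) - (A \<union> C) = B - A"
    using assms by auto
  ultimately show ?thesis using eqn_diff_iff assms by metis
qed

text \<open>Axiom (E1) only allows replacing one summand by a set disjoint from the other one. After
  padding to a common dimension, a copy of \<open>A\<close> ending in 1 is disjoint from everything that
  ends in 0, so the summands can be exchanged one at a time.\<close>

lemma eqn_Un:
  assumes dims: "k \<ge> 1" "A \<subseteq> tuples k" "B \<subseteq> tuples k" "l \<ge> 1" "A' \<subseteq> tuples l" "B' \<subseteq> tuples l"
    and disj: "A \<inter> B = {}" "A' \<inter> B' = {}"
    and eqn: "A \<approx> A'" "B \<approx> B'"
  shows "A \<union> B \<approx> A' \<union> B'"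
proof -
  \<comment> \<open>Sets of dimension \<open>k\<close> are padded by \<open>l\<close> letters and
    sets of dimension \<open>l\<close> by \<open>k\<close> letters, so all copies lie in dimension
    \<open>k + l\<close>.\<close>
  define p q r where "p = replicate l (0::nat)" and "q = replicate k (0::nat)" and "r = replicate l (1::nat)"
  have ne: "p \<noteq> []" "q \<noteq> []" "r \<noteq> []" and last: "last r \<noteq> last p" "last r \<noteq> last q"
    using dims by (auto simp: p_def q_def r_def)
  have dim: "X \<times>\<^sub>c {p} \<subseteq> tuples (k + l)" "X \<times>\<^sub>c {r} \<subseteq> tuples (k + l)" if "X \<subseteq> tuples k" for X
    using set_concat_tuples[OF that, of "{p}" l] set_concat_tuples[OF that, of "{r}" l]
    by (auto simp: p_def r_def tuples_def)
  have dim': "X \<times>\<^sub>c {q} \<subseteq> tuples (k + l)" if "X \<subseteq> tuples l" for X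
    using set_concat_tuples[OF that, of "{q}" k] by (auto simp: q_def tuples_def add.commute)
  have ps: "X \<union> Y \<in> point_sets" if "X \<subseteq> tuples (k + l)" "Y \<subseteq> tuples (k + l)" for X Y
    using that dims by (intro point_setsI[of "k + l"]) auto
  have A: "A \<in> point_sets" "A' \<in> point_sets" "B \<in> point_sets" "B' \<in> point_sets"
    "A \<union> B \<in> point_sets" "A' \<union> B' \<in> point_sets"
    using dims by (auto intro: point_setsI[of k] point_setsI[of l])
  have disj': "(A \<times>\<^sub>c {p}) \<inter> (B \<times>\<^sub>c {p}) = {}" "(A' \<times>\<^sub>c {q}) \<inter> (B' \<times>\<^sub>c {q}) = {}"
    using disj by (simp_all add: set_concat_singleton_Int) (simp_all add: set_concat_def)
  have pad: "A \<times>\<^sub>c {p} \<approx> A \<times>\<^sub>c {r}" "B \<times>\<^sub>c {p} \<approx> B' \<times>\<^sub>c {q}" "A \<times>\<^sub>c {r} \<approx> A' \<times>\<^sub>c {q}"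
    by (rule eqn_trans[OF eqn_pad[OF A(1) ne(1)] eqn_sym[OF eqn_pad[OF A(1) ne(3)]]],
        rule eqn_trans[OF eqn_pad[OF A(3) ne(1)] eqn_trans[OF eqn(2) eqn_sym[OF eqn_pad[OF A(4) ne(2)]]]],
        rule eqn_trans[OF eqn_pad[OF A(1) ne(3)] eqn_trans[OF eqn(1) eqn_sym[OF eqn_pad[OF A(2) ne(2)]]]])
  have "A \<union> B \<approx> A \<times>\<^sub>c {p} \<union> B \<times>\<^sub>c {p}"
    using eqn_pad[OF A(5) ne(1)] by (simp add: eqn_sym Un_set_concat)
  also have "A \<times>\<^sub>c {p} \<union> B \<times>\<^sub>c {p} \<approx> A \<times>\<^sub>c {r} \<union> B \<times>\<^sub>c {p}"
    using pad(1) disj' dims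
    by (subst eqn_Un_right_iff) (auto intro!: ps dim set_concat_disjoint[OF last(1) ne(3,1)])
  also have "A \<times>\<^sub>c {r} \<union> B \<times>\<^sub>c {p} \<approx> A \<times>\<^sub>c {r} \<union> B' \<times>\<^sub>c {q}"
    using pad(2) dims set_concat_disjoint[OF last(1) ne(3,1)] set_concat_disjoint[OF last(2) ne(3,2)]
    by (subst (1 2) Un_commute, subst eqn_Un_right_iff) (auto intro!: ps dim dim' simp: Int_commute)
  also have "A \<times>\<^sub>c {r} \<union> B' \<times>\<^sub>c {q} \<approx> A' \<times>\<^sub>c {q} \<union> B' \<times>\<^sub>c {q}"
    using pad(3) disj' dims
    by (subst eqn_Un_right_iff) (auto intro!: ps dim dim' set_concat_disjoint[OF last(2) ne(3,2)])
  also have "A' \<times>\<^sub>c {q} \<union> B' \<times>\<^sub>c {q} \<approx> A' \<union> B'"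
    using eqn_pad[OF A(6) ne(2)] by (simp add: Un_set_concat)
  finally show ?thesis .
qed

text \<open>A proper subset \<open>C\<close> of \<open>A'\<close> stays proper after
  \<open>B'\<close> is added, because \<open>B'\<close> misses the points of
  \<open>A' - C\<close>.\<close>

lemma less_num_Un:
  assumes "k \<ge> 1" "A \<subseteq> tuples k" "B \<subseteq> tuples k" "l \<ge> 1" "A' \<subseteq> tuples l" "B' \<subseteq> tuples l"
    and "A \<inter> B = {}" "A' \<inter> B' = {}" "A \<prec> A'" "B \<approx> B'"
  shows "A \<union> B \<prec> A' \<union> B'"
proof -
  from \<open>A \<prec> A'\<close> obtain C where C: "C \<subset> A'" "A \<approx> C" by (auto simp: less_num_def)
  have "A \<union> B \<approx> C \<union> B'"
    using assms C by (intro eqn_Un[where k = k and l = l]) auto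
  moreover have "C \<union> B' \<subset> A' \<union> B'" using C assms(8) by auto
  ultimately show ?thesis by (auto simp: less_num_def)
qed

text \<open>Moving the finitely many points of \<open>A\<close> inside \<open>{0..m}\<^sup>k\<close> out to height \<open>m\<close> makes the first
  counts vanish without changing the numerosity or the later counts.\<close>

lemma ex_eqn_delayed:
  assumes "A \<in> point_sets"
  shows "\<exists>A'. A' \<approx> A \<and> (\<forall>n. cnt A' n = (if n \<ge> m then cnt A n else 0))"
proof -
  from assms obtain k where k: "k \<ge> 1" "A \<subseteq> tuples k" by (rule point_setsE)
  define T where "T = trunc A m"
  have T: "T \<subseteq> A" by (auto simp: T_def trunc_def)
  \<comment> \<open>The points outside \<open>T\<close> have a letter above \<open>m\<close> already
    and may be padded by 0; those in \<open>T\<close> receive the letter \<open>m\<close>. Hence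
    nothing is counted before \<open>m\<close>, and the counts from \<open>m\<close> on are
    unchanged.\<close>
  define A' where "A' = (A - T) \<times>\<^sub>c {[0]} \<union> T \<times>\<^sub>c {[m]}"
  define ext where "ext x = x @ [if x \<in> T then m else 0]" for x
  have img: "A' = ext ` A"
    using T by (auto simp: A'_def ext_def set_concat_def)
  have "(A - T) \<times>\<^sub>c {[0]} \<union> T \<times>\<^sub>c {[m]} \<approx> (A - T) \<union> T"
  proof (rule eqn_Un)
    show "(A - T) \<times>\<^sub>c {[0]} \<subseteq> tuples (k + 1)" "T \<times>\<^sub>c {[m]} \<subseteq> tuples (k + 1)"
      by (rule set_concat_tuples; use k T in \<open>auto simp: tuples_def\<close>)+
    show "(A - T) \<times>\<^sub>c {[0]} \<approx> A - T" "T \<times>\<^sub>c {[m]} \<approx> T"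
      using assms T by (auto intro!: eqn_pad intro: point_sets_subset)
  qed (use k T in \<open>auto simp: set_concat_def\<close>)
  then have "A' \<approx> A" using T by (simp add: A'_def Un_absorb2)
  moreover have "cnt A' n = (if n \<ge> m then cnt A n else 0)" for n
  proof (cases "n \<ge> m")
    case True
    then have "trunc A' n = ext ` trunc A n"
      by (auto simp: img trunc_def ext_def)
    moreover have "inj_on ext (trunc A n)" by (auto simp: inj_on_def ext_def)
    ultimately show ?thesis using True by (simp add: cnt_def card_image)
  next
    case False
    then have "trunc A' n = {}"
      by (auto simp: img trunc_def ext_def T_def) (meson le_trans not_le less_imp_le)
    then show ?thesis using False by (simp add: cnt_def)
  qed
  ultimately show ?thesis by blast
qed

text \<open>Axiom (E0) asks for the inequality at every index, so \<open>A\<close> is first replaced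
  by a copy whose counts vanish below the threshold. That copy is then equinumerous to a subset of
  \<open>B\<close>, which excludes \<open>B \<prec> A\<close>.\<close>

lemma not_less_num_of_cnt_le:
  assumes "A \<in> point_sets" "B \<in> point_sets" "\<forall>\<^sub>F n in sequentially. cnt A n \<le> cnt B n"
  shows "\<not> B \<prec> A"
proof -
  from assms(3) obtain m where m: "\<And>n. n \<ge> m \<Longrightarrow> cnt A n \<le> cnt B n"
    by (auto simp: eventually_sequentially)
  from ex_eqn_delayed[OF assms(1)] obtain A' where
    A': "A' \<approx> A" "\<And>n. cnt A' n = (if n \<ge> m then cnt A n else 0)" by blast
  have "card (trunc A' n) \<le> card (trunc B n)" for n
    using m[of n] A'(2)[of n] by (auto simp: cnt_def split: if_splits)
  then obtain C where "C \<subseteq> B" "A' \<approx> C"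
    using asymptotic assms(2) eqn_point_sets[OF A'(1)] unfolding asymptotic_def by metis
  then have "A' \<approx> B \<or> A' \<prec> B" by (auto simp: less_num_def psubset_eq)
  then have "\<not> B \<prec> A'"
    using trichotomy[of A' B] eqn_point_sets[OF A'(1)] assms(2) by (auto simp: exactly_one_def)
  then show ?thesis
    using less_num_cong[OF eqn_refl[OF assms(2)] A'(1)] by simp
qed

lemma eqn_of_cnt_eq:
  assumes "A \<in> point_sets" "B \<in> point_sets" "\<forall>\<^sub>F n in sequentially. cnt A n = cnt B n"
  shows "A \<approx> B"
proof -
  have "\<not> B \<prec> A" "\<not> A \<prec> B"
    using assms by (intro not_less_num_of_cnt_le; simp add: eventually_mono)+
  then show ?thesis using trichotomy[OF assms(1,2)] by (auto simp: exactly_one_def)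
qed


subsection \<open>Sums\<close>

text \<open>A relation rather than an operation, since a representative of the sum of two
  numerosities depends on the disjoint copies chosen; \<open>is_sum_eqn\<close> shows that its class
  does not.\<close>

definition is_sum :: "nat list set \<Rightarrow> nat list set \<Rightarrow> nat list set \<Rightarrow> bool" where
  "is_sum A B C \<longleftrightarrow> (\<exists>A' B' k. A \<approx> A' \<and> B \<approx> B' \<and> A' \<inter> B' = {} \<and>
     k \<ge> 1 \<and> A' \<subseteq> tuples k \<and> B' \<subseteq> tuples k \<and> C = A' \<union> B')"

lemma is_sum_point_sets:
  assumes "is_sum A B C"
  shows "C \<in> point_sets"
proof -
  from assms obtain A' B' k where "k \<ge> 1" "A' \<subseteq> tuples k" "B' \<subseteq> tuples k" "C = A' \<union> B'"
    unfolding is_sum_def by blast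
  then show ?thesis by (simp add: point_setsI)
qed

text \<open>Padding one set by zeros and the other by ones makes them disjoint. The ones are counted
  only from index 1 on, so the counts add up eventually.\<close>

lemma ex_is_sum:
  assumes "A \<in> point_sets" "B \<in> point_sets"
  shows "\<exists>C. is_sum A B C \<and> (\<forall>\<^sub>F n in sequentially. cnt C n = cnt A n + cnt B n)"
proof -
  from assms obtain k l where kl: "k \<ge> 1" "A \<subseteq> tuples k" "l \<ge> 1" "B \<subseteq> tuples l"
    by (metis point_setsE)
  define p q where "p = replicate l (0::nat)" and "q = replicate k (1::nat)"
  have ne: "p \<noteq> []" "q \<noteq> []" using kl by (auto simp: p_def q_def)
  have dis: "(A \<times>\<^sub>c {p}) \<inter> (B \<times>\<^sub>c {q}) = {}"
    using ne kl by (intro set_concat_disjoint) (auto simp: p_def q_def)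
  have "A \<times>\<^sub>c {p} \<subseteq> tuples (k + l)" "B \<times>\<^sub>c {q} \<subseteq> tuples (k + l)"
    using set_concat_tuples[OF kl(2), of "{p}" l] set_concat_tuples[OF kl(4), of "{q}" k]
    by (auto simp: p_def q_def tuples_def add.commute)
  with dis have "is_sum A B (A \<times>\<^sub>c {p} \<union> B \<times>\<^sub>c {q})"
    unfolding is_sum_def using kl ne assms eqn_pad eqn_sym
    by (intro exI[of _ "A \<times>\<^sub>c {p}"] exI[of _ "B \<times>\<^sub>c {q}"] exI[of _ "k + l"] conjI) auto
  moreover have "\<forall>\<^sub>F n in sequentially. cnt (A \<times>\<^sub>c {p} \<union> B \<times>\<^sub>c {q}) n = cnt A n + cnt B n"
    using eventually_cnt_singleton[of p] eventually_cnt_singleton[of q]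
    by eventually_elim
      (use assms ne in \<open>simp add: cnt_Un_disjoint dis set_concat_point_sets singleton_point_sets cnt_set_concat\<close>)
  ultimately show ?thesis by blast
qed

lemma is_sum_eqn:
  assumes "is_sum A B C" "is_sum A' B' C'" "A \<approx> A'" "B \<approx> B'"
  shows "C \<approx> C'"
proof -
  obtain X Y k where C: "A \<approx> X" "B \<approx> Y" "X \<inter> Y = {}" "k \<ge> 1" "X \<subseteq> tuples k" "Y \<subseteq> tuples k" "C = X \<union> Y"
    using assms(1) unfolding is_sum_def by blast
  obtain X' Y' k' where C': "A' \<approx> X'" "B' \<approx> Y'" "X' \<inter> Y' = {}" "k' \<ge> 1" "X' \<subseteq> tuples k'"
      "Y' \<subseteq> tuples k'" "C' = X' \<union> Y'"
    using assms(2) unfolding is_sum_def by blast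
  have "X \<approx> X'" "Y \<approx> Y'"
    by (rule eqn_trans[OF eqn_sym[OF C(1)] eqn_trans[OF assms(3) C'(1)]],
        rule eqn_trans[OF eqn_sym[OF C(2)] eqn_trans[OF assms(4) C'(2)]])
  with C C' show ?thesis by (simp add: eqn_Un)
qed

lemma is_sum_less_num:
  assumes "is_sum A B C" "is_sum A' B' C'" "A \<prec> A'" "B \<approx> B'"
  shows "C \<prec> C'"
proof -
  obtain X Y k where C: "A \<approx> X" "B \<approx> Y" "X \<inter> Y = {}" "k \<ge> 1" "X \<subseteq> tuples k" "Y \<subseteq> tuples k" "C = X \<union> Y"
    using assms(1) unfolding is_sum_def by blast
  obtain X' Y' k' where C': "A' \<approx> X'" "B' \<approx> Y'" "X' \<inter> Y' = {}" "k' \<ge> 1" "X' \<subseteq> tuples k'"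
      "Y' \<subseteq> tuples k'" "C' = X' \<union> Y'"
    using assms(2) unfolding is_sum_def by blast
  have "X \<prec> X'"
    using less_num_cong[OF C(1) C'(1)] assms(3) by simp
  moreover have "Y \<approx> Y'"
    by (rule eqn_trans[OF eqn_sym[OF C(2)] eqn_trans[OF assms(4) C'(2)]])
  ultimately show ?thesis using C C' by (simp add: less_num_Un)
qed

text \<open>Comparison of counts up to an equinumerous pair: adding \<open>B'\<close> and
  \<open>B\<close> to a hypothetical \<open>A' \<prec> A\<close> gives sums in the same strict
  order, against the inequality of their counts.\<close>

lemma not_less_num_of_sum_cnt_le:
  assumes "B \<approx> B'" "A \<in> point_sets" "A' \<in> point_sets"
    and "\<forall>\<^sub>F n in sequentially. cnt A n + cnt B n \<le> cnt A' n + cnt B' n"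
  shows "\<not> A' \<prec> A"
proof
  assume less: "A' \<prec> A"
  obtain C where C: "is_sum A B C" "\<forall>\<^sub>F n in sequentially. cnt C n = cnt A n + cnt B n"
    using ex_is_sum assms eqn_point_sets by metis
  obtain C' where C': "is_sum A' B' C'" "\<forall>\<^sub>F n in sequentially. cnt C' n = cnt A' n + cnt B' n"
    using ex_is_sum assms eqn_point_sets by metis
  from C(2) C'(2) assms(4) have "\<forall>\<^sub>F n in sequentially. cnt C n \<le> cnt C' n"
    by eventually_elim simp
  then have "\<not> C' \<prec> C"
    using C C' is_sum_point_sets by (intro not_less_num_of_cnt_le)
  moreover have "C' \<prec> C"
    by (rule is_sum_less_num[OF C'(1) C(1) less eqn_sym[OF assms(1)]])
  ultimately show False by simp
qed

lemma eqn_of_sum_cnt_eq: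
  assumes "B \<approx> B'" "A \<in> point_sets" "A' \<in> point_sets"
    and "\<forall>\<^sub>F n in sequentially. cnt A n + cnt B n = cnt A' n + cnt B' n"
  shows "A \<approx> A'"
proof -
  have "\<not> A' \<prec> A"
    using assms by (intro not_less_num_of_sum_cnt_le[of B B']) (auto elim: eventually_mono)
  moreover have "\<not> A \<prec> A'"
    using assms eqn_sym by (intro not_less_num_of_sum_cnt_le[of B' B]) (auto elim: eventually_mono)
  ultimately show ?thesis using trichotomy[OF assms(2,3)] by (auto simp: exactly_one_def)
qed


subsection \<open>The ideal of negligible sequences\<close>

text \<open>This will be the kernel of every numerosity homomorphism. Eventual equality puts all
  eventually vanishing sequences into it.\<close>

definition negligible :: "(nat \<Rightarrow> int) set" where
  "negligible = {f \<in> poly_bounded. \<exists>A B. A \<approx> B \<and> (\<forall>\<^sub>F n in sequentially. f n = cnt A n - cnt B n)}"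

lemma negligible_poly_bounded: "f \<in> negligible \<Longrightarrow> f \<in> poly_bounded"
  by (simp add: negligible_def)

lemma negligible_cong:
  assumes "f \<in> negligible" "g \<in> poly_bounded" "\<forall>\<^sub>F n in sequentially. g n = f n"
  shows "g \<in> negligible"
proof -
  from assms(1) obtain A B where AB: "A \<approx> B" "\<forall>\<^sub>F n in sequentially. f n = cnt A n - cnt B n"
    by (auto simp: negligible_def)
  from AB(2) assms(3) have "\<forall>\<^sub>F n in sequentially. g n = cnt A n - cnt B n"
    by eventually_elim simp
  then show ?thesis using AB(1) assms(2) by (auto simp: negligible_def)
qed

lemma cnt_diff_poly_bounded:
  "A \<in> point_sets \<Longrightarrow> B \<in> point_sets \<Longrightarrow> (\<lambda>n. cnt A n - cnt B n) \<in> poly_bounded"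
  by (intro poly_bounded_diff cnt_poly_bounded)

lemma cnt_diff_negligible:
  assumes "A \<approx> B"
  shows "(\<lambda>n. cnt A n - cnt B n) \<in> negligible"
  unfolding negligible_def using assms eqn_point_sets[OF assms] cnt_diff_poly_bounded[of A B]
  by (intro CollectI conjI exI[of _ A] exI[of _ B]) simp_all

text \<open>If one difference of counts comes from an equinumerous pair, the pair can be cancelled
  from any other difference with eventually the same values.\<close>

lemma cnt_diff_negligible_iff:
  assumes "A \<in> point_sets" "B \<in> point_sets"
  shows "(\<lambda>n. cnt A n - cnt B n) \<in> negligible \<longleftrightarrow> A \<approx> B"
proof
  assume "(\<lambda>n. cnt A n - cnt B n) \<in> negligible"
  then obtain A' B' where *: "A' \<approx> B'"
      "\<forall>\<^sub>F n in sequentially. cnt A n - cnt B n = cnt A' n - cnt B' n"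
    by (auto simp: negligible_def)
  from *(2) have "\<forall>\<^sub>F n in sequentially. cnt A n + cnt B' n = cnt B n + cnt A' n"
    by eventually_elim simp
  then show "A \<approx> B"
    by (rule eqn_of_sum_cnt_eq[OF eqn_sym[OF *(1)] assms])
qed (rule cnt_diff_negligible)

lemma negligible_eventually_0:
  assumes "\<forall>\<^sub>F n in sequentially. f n = 0" "f \<in> poly_bounded"
  shows "f \<in> negligible"
  using assms eqn_refl[OF empty_point_sets] unfolding negligible_def
  by (intro CollectI conjI exI[of _ "{}"]) simp_all

lemma negligible_uminus:
  assumes "f \<in> negligible"
  shows "(\<lambda>n. - f n) \<in> negligible"
proof -
  from assms obtain A B where AB: "A \<approx> B" "\<forall>\<^sub>F n in sequentially. f n = cnt A n - cnt B n"
    by (auto simp: negligible_def)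
  from AB(2) have "\<forall>\<^sub>F n in sequentially. - f n = cnt B n - cnt A n"
    by eventually_elim simp
  then show ?thesis
    using negligible_cong[OF cnt_diff_negligible[OF eqn_sym[OF AB(1)]]]
      negligible_poly_bounded[OF assms] poly_bounded_uminus by blast
qed

lemma negligible_add:
  assumes "f \<in> negligible" "g \<in> negligible"
  shows "(\<lambda>n. f n + g n) \<in> negligible"
proof -
  from assms obtain A B A' B' where
    f: "A \<approx> B" "\<forall>\<^sub>F n in sequentially. f n = cnt A n - cnt B n" and
    g: "A' \<approx> B'" "\<forall>\<^sub>F n in sequentially. g n = cnt A' n - cnt B' n"
    unfolding negligible_def by blast
  obtain C where C: "is_sum A A' C" "\<forall>\<^sub>F n in sequentially. cnt C n = cnt A n + cnt A' n"
    using ex_is_sum f(1) g(1) eqn_point_sets by metis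
  obtain D where D: "is_sum B B' D" "\<forall>\<^sub>F n in sequentially. cnt D n = cnt B n + cnt B' n"
    using ex_is_sum f(1) g(1) eqn_point_sets by metis
  have "C \<approx> D" using C(1) D(1) f(1) g(1) by (rule is_sum_eqn)
  moreover from f(2) g(2) C(2) D(2)
  have "\<forall>\<^sub>F n in sequentially. f n + g n = cnt C n - cnt D n"
    by eventually_elim simp
  ultimately show ?thesis
    using assms negligible_poly_bounded poly_bounded_add unfolding negligible_def by blast
qed

lemma negligible_diff:
  "f \<in> negligible \<Longrightarrow> g \<in> negligible \<Longrightarrow> (\<lambda>n. f n - g n) \<in> negligible"
  using negligible_add[of f "\<lambda>n. - g n"] negligible_uminus by simp

text \<open>With the multiplier written as \<open>cnt A - cnt B\<close>, axiom (E4) turns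
  \<open>X \<approx> Y\<close> into equinumerous products with \<open>A\<close> and with
  \<open>B\<close>.\<close>

lemma negligible_mult:
  assumes "f \<in> poly_bounded" "g \<in> negligible"
  shows "(\<lambda>n. f n * g n) \<in> negligible"
proof -
  obtain A B where f: "A \<in> point_sets" "B \<in> point_sets" "\<forall>\<^sub>F n in sequentially. f n = cnt A n - cnt B n"
    using poly_bounded_eventually_cnt_diff[OF assms(1)] by blast
  obtain X Y where g: "X \<approx> Y" "\<forall>\<^sub>F n in sequentially. g n = cnt X n - cnt Y n"
    using assms(2) unfolding negligible_def by blast
  have "(\<lambda>n. (cnt (A \<times>\<^sub>c X) n - cnt (A \<times>\<^sub>c Y) n) - (cnt (B \<times>\<^sub>c X) n - cnt (B \<times>\<^sub>c Y) n)) \<in> negligible"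
    using f(1,2) g(1) by (intro negligible_diff cnt_diff_negligible eqn_set_concat eqn_refl)
  moreover from f(3) g(2) have "\<forall>\<^sub>F n in sequentially. f n * g n =
      (cnt (A \<times>\<^sub>c X) n - cnt (A \<times>\<^sub>c Y) n) - (cnt (B \<times>\<^sub>c X) n - cnt (B \<times>\<^sub>c Y) n)"
  proof eventually_elim
    case (elim n)
    show ?case unfolding elim using f(1,2) by (simp add: cnt_set_concat algebra_simps)
  qed
  ultimately show ?thesis
    using poly_bounded_mult[OF assms(1) negligible_poly_bounded[OF assms(2)]] negligible_cong by blast
qed

text \<open>For \<open>g\<close> eventually equal to \<open>cnt A - cnt B\<close>, the lower bound 0
  excludes \<open>A \<prec> B\<close>; the upper bound \<open>f\<close> excludes
  \<open>B \<prec> A\<close> after cancelling the equinumerous pair that represents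
  \<open>f\<close>.\<close>

lemma negligible_convex:
  assumes "f \<in> negligible" "g \<in> poly_bounded" "\<And>n. 0 \<le> g n" "\<And>n. g n \<le> f n"
  shows "g \<in> negligible"
proof -
  obtain A B where g: "A \<in> point_sets" "B \<in> point_sets" "\<forall>\<^sub>F n in sequentially. g n = cnt A n - cnt B n"
    using poly_bounded_eventually_cnt_diff[OF assms(2)] by blast
  obtain X Y where f: "X \<approx> Y" "\<forall>\<^sub>F n in sequentially. f n = cnt X n - cnt Y n"
    using assms(1) unfolding negligible_def by blast
  from g(3) have "\<forall>\<^sub>F n in sequentially. cnt B n \<le> cnt A n"
    by eventually_elim (use assms(3) in \<open>metis diff_ge_0_iff_ge\<close>)
  then have "\<not> A \<prec> B" using g by (intro not_less_num_of_cnt_le)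
  moreover from g(3) f(2) have "\<forall>\<^sub>F n in sequentially. cnt A n + cnt Y n \<le> cnt B n + cnt X n"
  proof eventually_elim
    case (elim n)
    then show ?case using assms(4)[of n] by linarith
  qed
  then have "\<not> B \<prec> A" using g f(1) eqn_sym by (intro not_less_num_of_sum_cnt_le[of Y X])
  ultimately have "A \<approx> B" using trichotomy[of A B] g by (auto simp: exactly_one_def)
  then show ?thesis using g assms(2) by (auto simp: negligible_def)
qed

lemma one_not_negligible: "(\<lambda>n. 1) \<notin> negligible"
proof
  have pt: "{[0::nat]} \<in> point_sets" by (rule singleton_point_sets) simp
  assume "(\<lambda>n. 1) \<in> negligible"
  then have "(\<lambda>n. cnt {[0]} n - cnt {} n) \<in> negligible"
    by (simp add: cnt_singleton)
  then have "{[0]} \<approx> {}"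
    using pt by (simp add: cnt_diff_negligible_iff empty_point_sets del: cnt_empty)
  moreover have "{} \<prec> {[0]}"
    using eqn_refl[OF empty_point_sets] by (auto simp: less_num_def)
  ultimately show False
    using trichotomy[OF pt empty_point_sets] by (auto simp: exactly_one_def)
qed

text \<open>Zeros of \<open>f\<close> are zeros of \<open>g\<close> iff \<open>\<bar>g\<bar> \<le> g\<^sup>2 f\<^sup>2\<close>; this replaces a division of \<open>g\<close> by \<open>f\<close>.\<close>

lemma negligible_zeros:
  assumes "f \<in> negligible" "g \<in> poly_bounded" "\<And>n. f n = 0 \<Longrightarrow> g n = 0"
  shows "g \<in> negligible"
proof -
  have f: "f \<in> poly_bounded" using assms(1) by (rule negligible_poly_bounded)
  have "(\<lambda>n. (g n * (g n * f n)) * f n) \<in> negligible"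
    using assms f by (intro negligible_mult poly_bounded_mult)
  moreover have "(\<lambda>n. \<bar>g n\<bar>) \<in> poly_bounded"
    by (rule poly_bounded_dominated[OF assms(2)]) simp
  moreover have "0 \<le> \<bar>g n\<bar>" for n by simp
  moreover have "\<bar>g n\<bar> \<le> (g n * (g n * f n)) * f n" for n
  proof (cases "g n = 0")
    case False
    then have "\<bar>g n\<bar> \<ge> 1" "\<bar>f n\<bar> \<ge> 1" using assms(3)[of n] by linarith+
    then have "(1 * \<bar>g n\<bar>) * (1 * 1) \<le> (\<bar>g n\<bar> * \<bar>g n\<bar>) * (\<bar>f n\<bar> * \<bar>f n\<bar>)"
      by (intro mult_mono) (auto intro: order.trans[OF _ mult_mono[of 1 _ 1]])
    then show ?thesis by (simp add: mult_ac)
  qed simp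
  ultimately have "(\<lambda>n. \<bar>g n\<bar>) \<in> negligible" by (rule negligible_convex)
  \<comment> \<open>The sign sequence is bounded, so multiplying by it recovers \<open>g\<close>
    from its absolute value within the ideal.\<close>
  moreover have "(\<lambda>n. sgn (g n)) \<in> poly_bounded"
    by (rule poly_bounded_dominated[OF poly_bounded_const[of 1]]) (simp add: abs_sgn_eq)
  ultimately have "(\<lambda>n. sgn (g n) * \<bar>g n\<bar>) \<in> negligible" by (intro negligible_mult)
  then show ?thesis by (simp add: sgn_mult_abs)
qed

text \<open>A numerosity strictly above that of \<open>B\<close> exceeds it by at least 1: the ring is discretely ordered.\<close>

lemma negligible_01:
  assumes "\<And>n. e n \<in> {0, 1}"
  shows "e \<in> negligible \<or> (\<lambda>n. 1 - e n) \<in> negligible"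
proof -
  have e: "0 \<le> e n" "e n \<le> 1" for n using assms[of n] by auto
  have eP: "e \<in> poly_bounded"
    by (rule poly_bounded_dominated[OF poly_bounded_const[of 1]]) (use e in auto)
  then obtain A B where AB: "A \<in> point_sets" "B \<in> point_sets"
      "\<forall>\<^sub>F n in sequentially. e n = cnt A n - cnt B n"
    using poly_bounded_eventually_cnt_diff by blast
  from AB(3) have "\<forall>\<^sub>F n in sequentially. cnt B n \<le> cnt A n"
    by eventually_elim (use e in \<open>metis diff_ge_0_iff_ge\<close>)
  then have "\<not> A \<prec> B" using AB by (intro not_less_num_of_cnt_le)
  then consider "A \<approx> B" | "B \<prec> A" using trichotomy[of A B] AB by (auto simp: exactly_one_def)
  then show ?thesis
  proof cases
    case 1
    then show ?thesis using AB(3) eP by (auto simp: negligible_def)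
  next
    case 2
    then obtain D where D: "D \<subset> A" "B \<approx> D" by (auto simp: less_num_def)
    then obtain q where q: "q \<in> A" "q \<notin> D" by blast
    have ps: "D \<in> point_sets" "{q} \<in> point_sets" "D \<union> {q} \<in> point_sets"
      using D(1) q AB(1) by (auto intro: point_sets_subset[OF AB(1)])
    have Dq: "\<forall>\<^sub>F n in sequentially. cnt (D \<union> {q}) n = cnt D n + 1"
      using eventually_cnt_singleton[of q]
      by eventually_elim (use q ps in \<open>simp add: cnt_Un_disjoint del: Un_insert_right\<close>)
    from Dq AB(3) have "\<forall>\<^sub>F n in sequentially. cnt A n + cnt D n \<le> cnt (D \<union> {q}) n + cnt B n"
    proof eventually_elim
      case (elim n)
      then show ?case using e[of n] by linarith
    qed
    then have less: "\<not> D \<union> {q} \<prec> A"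
      using AB ps D(2) eqn_sym by (intro not_less_num_of_sum_cnt_le[of D B])
    \<comment> \<open>A second point in \<open>A - D\<close> would put \<open>D \<union> {q}\<close>
      strictly below \<open>A\<close>, although \<open>A\<close> exceeds \<open>B\<close>, hence
      \<open>D\<close>, by at most 1.\<close>
    have "D \<union> {q} = A"
    proof (rule ccontr)
      assume "D \<union> {q} \<noteq> A"
      then have "D \<union> {q} \<subset> A" using D(1) q(1) by auto
      then have "D \<union> {q} \<prec> A"
        unfolding less_num_def using eqn_refl[OF ps(3)] by (intro exI[of _ "D \<union> {q}"] conjI)
      with less show False ..
    qed
    have "\<forall>\<^sub>F n in sequentially. 1 - e n = cnt B n - cnt D n"
      using Dq AB(3) unfolding \<open>D \<union> {q} = A\<close> by eventually_elim simp
    then have "(\<lambda>n. 1 - e n) \<in> negligible"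
      using D(2) poly_bounded_diff[OF poly_bounded_const eP] unfolding negligible_def by blast
    then show ?thesis ..
  qed
qed

text \<open>Since \<open>cnt B\<close> is eventually at most \<open>cnt A\<close>, a copy
  \<open>D\<close> of \<open>B\<close> fits inside \<open>A\<close>. Trading \<open>B\<close> for
  \<open>D\<close> costs a negligible sequence and leaves the counts of
  \<open>A - D\<close>.\<close>

lemma ex_cnt_diff_negligible:
  assumes "f \<in> poly_bounded" "\<And>n. f n \<ge> 0"
  shows "\<exists>X\<in>point_sets. (\<lambda>n. f n - cnt X n) \<in> negligible"
proof -
  obtain A B where AB: "A \<in> point_sets" "B \<in> point_sets"
      "\<forall>\<^sub>F n in sequentially. f n = cnt A n - cnt B n"
    using poly_bounded_eventually_cnt_diff[OF assms(1)] by blast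
  from AB(3) have "\<forall>\<^sub>F n in sequentially. cnt B n \<le> cnt A n"
    by eventually_elim (use assms(2) in \<open>metis diff_ge_0_iff_ge\<close>)
  then have "\<not> A \<prec> B" using AB by (intro not_less_num_of_cnt_le)
  then have "A \<approx> B \<or> B \<prec> A" using trichotomy[of A B] AB by (auto simp: exactly_one_def)
  then obtain D where D: "D \<subseteq> A" "B \<approx> D"
    using eqn_sym unfolding less_num_def by blast
  have ps: "D \<in> point_sets" "A - D \<in> point_sets"
    using D(1) AB(1) by (auto intro: point_sets_subset)
  have "cnt A n = cnt D n + cnt (A - D) n" for n
    using cnt_Un_disjoint[OF ps, of n] D(1) by (simp add: Un_absorb1)
  with AB(3) have "\<forall>\<^sub>F n in sequentially. f n - cnt (A - D) n = cnt D n - cnt B n"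
    by (simp add: eventually_mono)
  then have "(\<lambda>n. f n - cnt (A - D) n) \<in> negligible"
    using eqn_sym[OF D(2)] poly_bounded_diff[OF assms(1) cnt_poly_bounded[OF ps(2)]]
    unfolding negligible_def by blast
  then show ?thesis using ps by blast
qed


subsection \<open>The ultrafilter\<close>

definition zero_filter :: "nat filter" where
  "zero_filter = Abs_filter (\<lambda>P. \<exists>f\<in>negligible. \<forall>n. f n = 0 \<longrightarrow> P n)"

lemma eventually_zero_filter:
  "eventually P zero_filter \<longleftrightarrow> (\<exists>f\<in>negligible. \<forall>n. f n = 0 \<longrightarrow> P n)"
  unfolding zero_filter_def
proof (rule eventually_Abs_filter, unfold_locales)
  have "(\<lambda>n. 0) \<in> negligible"
    by (rule negligible_eventually_0) (simp_all add: poly_bounded_const)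
  then show "\<exists>f\<in>negligible. \<forall>n. f n = 0 \<longrightarrow> True" by blast
next
  fix P Q :: "nat \<Rightarrow> bool"
  assume "\<exists>f\<in>negligible. \<forall>n. f n = 0 \<longrightarrow> P n" "\<exists>f\<in>negligible. \<forall>n. f n = 0 \<longrightarrow> Q n"
  then obtain f g where *: "f \<in> negligible" "\<And>n. f n = 0 \<Longrightarrow> P n"
      "g \<in> negligible" "\<And>n. g n = 0 \<Longrightarrow> Q n"
    by blast
  \<comment> \<open>The sum of squares vanishes exactly at the common zeros, which gives closure
    under intersection.\<close>
  have "(\<lambda>n. f n * f n + g n * g n) \<in> negligible"
    using * by (intro negligible_add negligible_mult negligible_poly_bounded)
  moreover have "f n * f n + g n * g n = 0 \<longrightarrow> P n \<and> Q n" for n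
    using *(2,4)[of n] by (simp add: sum_squares_eq_zero_iff)
  ultimately show "\<exists>f\<in>negligible. \<forall>n. f n = 0 \<longrightarrow> P n \<and> Q n"
    by (intro bexI[of _ "\<lambda>n. f n * f n + g n * g n"]) auto
qed blast

text \<open>By \<open>negligible_zeros\<close>, membership in the ideal depends only on the zero
  set, so enlarging zero sets to form a filter adds no new sequences.\<close>

lemma eventually_zero_iff_negligible:
  assumes "g \<in> poly_bounded"
  shows "(\<forall>\<^sub>F n in zero_filter. g n = 0) \<longleftrightarrow> g \<in> negligible"
  using assms negligible_zeros unfolding eventually_zero_filter by blast

lemma ultrafilter_zero_filter: "ultrafilter zero_filter"
  unfolding ultrafilter_def
proof (intro conjI allI)
  have "\<not> (\<forall>\<^sub>F n in zero_filter. (1::int) = 0)"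
    using eventually_zero_iff_negligible[OF poly_bounded_const] one_not_negligible by blast
  then show "zero_filter \<noteq> bot" by (auto simp: trivial_limit_def)
  fix P :: "nat \<Rightarrow> bool"
  \<comment> \<open>The zeros of \<open>e\<close> are the points where \<open>P\<close> holds, and
    those of \<open>1 - e\<close> the points where it fails; one of these two idempotents is
    negligible.\<close>
  define e where "e n = (if P n then 0 else 1 :: int)" for n
  have "e \<in> negligible \<or> (\<lambda>n. 1 - e n) \<in> negligible"
    by (rule negligible_01) (simp add: e_def)
  then show "eventually P zero_filter \<or> eventually (\<lambda>n. \<not> P n) zero_filter"
  proof
    assume "e \<in> negligible"
    then have "eventually P zero_filter"
      unfolding eventually_zero_filter by (rule bexI[rotated]) (simp add: e_def)
    then show ?thesis ..
  next
    assume "(\<lambda>n. 1 - e n) \<in> negligible"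
    then have "eventually (\<lambda>n. \<not> P n) zero_filter"
      unfolding eventually_zero_filter by (rule bexI[rotated]) (simp add: e_def)
    then show ?thesis ..
  qed
qed

text \<open>The indicator of a point vanishes eventually and is negligible, so no point can lie in a
  generating set; the filter generated by the empty set is \<open>bot\<close>.\<close>

lemma nonprincipal_zero_filter: "nonprincipal zero_filter"
  unfolding nonprincipal_def
proof (intro allI notI)
  fix A assume A: "zero_filter = principal A"
  have "a \<notin> A" for a
  proof -
    have "\<forall>\<^sub>F n in sequentially. (if n = a then 1 else 0 :: int) = 0"
      using eventually_gt_at_top[of a] by eventually_elim auto
    moreover have "(\<lambda>n. if n = a then 1 else 0 :: int) \<in> poly_bounded"
      by (rule poly_bounded_dominated[OF poly_bounded_const[of 1]]) auto
    ultimately have "(\<lambda>n. if n = a then 1 else 0 :: int) \<in> negligible"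
      by (rule negligible_eventually_0)
    then have "eventually (\<lambda>n. n \<noteq> a) zero_filter"
      unfolding eventually_zero_filter by (rule bexI[rotated]) auto
    then show ?thesis by (auto simp: A eventually_principal)
  qed
  then have "A = {}" by blast
  then have "zero_filter = bot" using A by (simp flip: bot_eq_principal_empty)
  then show False using ultrafilter_zero_filter by (simp add: ultrafilter_def)
qed

text \<open>Every non-negative sequence is \<open>\<U>\<close>-almost equal to a counting function, which is monotone.\<close>

lemma quasi_selective_zero_filter: "quasi_selective zero_filter"
  unfolding quasi_selective_def
proof (intro conjI ultrafilter_zero_filter nonprincipal_zero_filter allI impI)
  fix f :: "nat \<Rightarrow> nat" assume f: "\<forall>n. f n \<le> n"
  have "\<bar>int (f n)\<bar> \<le> 1 * (int n + 1) ^ 1" for n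
    using f[rule_format, of n] by simp
  then have "(\<lambda>n. int (f n)) \<in> poly_bounded"
    unfolding poly_bounded_iff by blast
  then obtain X where X: "X \<in> point_sets" "(\<lambda>n. int (f n) - cnt X n) \<in> negligible"
    using ex_cnt_diff_negligible[of "\<lambda>n. int (f n)"] by auto
  have "mono (\<lambda>n. card (trunc X n))"
    by (intro monoI card_mono finite_trunc X) (auto simp: trunc_def)
  moreover have "\<forall>\<^sub>F n in zero_filter. f n = card (trunc X n)"
    unfolding eventually_zero_filter using X(2) by (rule bexI[rotated]) (simp add: cnt_def)
  ultimately show "\<exists>h. mono h \<and> (\<forall>\<^sub>F n in zero_filter. f n = h n)" by blast
qed


subsection \<open>The ring of differences of numerosities\<close>

abbreviation num :: "nat list set \<Rightarrow> nat list set set" where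
  "num \<equiv> numerosity E"

lemma num_eq_iff: "A \<in> point_sets \<Longrightarrow> B \<in> point_sets \<Longrightarrow> num A = num B \<longleftrightarrow> A \<approx> B"
  unfolding numerosity_def by (rule eq_equiv_class_iff[OF equiv])

lemma mem_num_iff: "X \<in> num A \<longleftrightarrow> A \<approx> X"
  by (simp add: numerosity_def)

lemma numerosities_eq: "numerosities E = num ` point_sets"
  by (auto simp: numerosities_def numerosity_def quotient_def)

text \<open>All admissible choices of disjoint representatives give the same class, so the union in
  \<open>num_add\<close> runs over a single value.\<close>

lemma num_add_num:
  assumes "A \<in> point_sets" "B \<in> point_sets"
  shows "\<exists>C\<in>point_sets. num_add E (num A) (num B) = num C \<and>
    (\<forall>\<^sub>F n in sequentially. cnt C n = cnt A n + cnt B n)"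
proof -
  obtain C where C: "is_sum A B C" "\<forall>\<^sub>F n in sequentially. cnt C n = cnt A n + cnt B n"
    using ex_is_sum[OF assms] by blast
  have "num_add E (num A) (num B) = \<Union> {num D | D. is_sum A B D}"
    unfolding num_add_def mem_num_iff is_sum_def by (rule arg_cong[of _ _ Union]) blast
  moreover have "{num D | D. is_sum A B D} = {num C}"
  proof -
    have "num D = num C" if "is_sum A B D" for D
      using is_sum_eqn[OF that C(1) eqn_refl[OF assms(1)] eqn_refl[OF assms(2)]]
      by (simp add: num_eq_iff is_sum_point_sets[OF C(1)] is_sum_point_sets[OF that])
    then show ?thesis using C(1) by blast
  qed
  ultimately show ?thesis
    using C(2) is_sum_point_sets[OF C(1)] by (intro bexI[of _ C]) auto
qed

lemma num_mult_num:
  assumes "A \<in> point_sets" "B \<in> point_sets"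
  shows "num_mult E (num A) (num B) = num (A \<times>\<^sub>c B)"
proof -
  have "num (X \<times>\<^sub>c Y) = num (A \<times>\<^sub>c B)" if "X \<in> num A" "Y \<in> num B" for X Y
    using that eqn_set_concat[of A X B Y]
    by (simp add: mem_num_iff numerosity_def equiv_class_eq[OF equiv])
  moreover have "A \<in> num A" "B \<in> num B"
    using assms by (auto simp: mem_num_iff eqn_refl)
  ultimately show ?thesis unfolding num_mult_def by blast
qed

text \<open>Translates equality of formal differences into congruence of differences of counting
  functions modulo the ideal.\<close>

lemma diff_rel_num_iff:
  assumes "A \<in> point_sets" "B \<in> point_sets" "C \<in> point_sets" "D \<in> point_sets"
  shows "((num A, num B), (num C, num D)) \<in> diff_rel E \<longleftrightarrow>
    (\<lambda>n. (cnt A n - cnt B n) - (cnt C n - cnt D n)) \<in> negligible"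
proof -
  obtain X where X: "X \<in> point_sets" "num_add E (num A) (num D) = num X"
      "\<forall>\<^sub>F n in sequentially. cnt X n = cnt A n + cnt D n"
    using num_add_num assms by blast
  obtain Y where Y: "Y \<in> point_sets" "num_add E (num C) (num B) = num Y"
      "\<forall>\<^sub>F n in sequentially. cnt Y n = cnt C n + cnt B n"
    using num_add_num assms by blast
  have ev: "\<forall>\<^sub>F n in sequentially. (cnt A n - cnt B n) - (cnt C n - cnt D n) = cnt X n - cnt Y n"
    using X(3) Y(3) by eventually_elim simp
  then have ev': "\<forall>\<^sub>F n in sequentially. cnt X n - cnt Y n = (cnt A n - cnt B n) - (cnt C n - cnt D n)"
    by eventually_elim simp
  have "((num A, num B), (num C, num D)) \<in> diff_rel E \<longleftrightarrow> num X = num Y"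
    using assms X(2) Y(2) by (simp add: diff_rel_def numerosities_eq)
  also have "\<dots> \<longleftrightarrow> (\<lambda>n. cnt X n - cnt Y n) \<in> negligible"
    using X(1) Y(1) by (simp add: num_eq_iff cnt_diff_negligible_iff)
  also have "\<dots> \<longleftrightarrow> (\<lambda>n. (cnt A n - cnt B n) - (cnt C n - cnt D n)) \<in> negligible"
    using negligible_cong[OF _ _ ev] negligible_cong[OF _ _ ev'] X(1) Y(1) assms
    by (auto simp: cnt_diff_poly_bounded poly_bounded_diff)
  finally show ?thesis .
qed

text \<open>For polynomially bounded \<open>g\<close> this is a full class of
  \<open>diff_rel\<close>: the differences congruent to \<open>g\<close>, collected without choosing
  a representative.\<close>

definition psi :: "(nat \<Rightarrow> int) \<Rightarrow> num_diff" where
  "psi g = {(num A, num B) | A B. A \<in> point_sets \<and> B \<in> point_sets \<and>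
     (\<lambda>n. g n - (cnt A n - cnt B n)) \<in> negligible}"

lemma psiE:
  assumes "u \<in> psi g"
  obtains A B where "u = (num A, num B)" "A \<in> point_sets" "B \<in> point_sets"
    "(\<lambda>n. g n - (cnt A n - cnt B n)) \<in> negligible"
  using assms unfolding psi_def by blast

lemma ex_cnt_diff_mod_negligible:
  assumes "g \<in> poly_bounded"
  shows "\<exists>A\<in>point_sets. \<exists>B\<in>point_sets. (\<lambda>n. g n - (cnt A n - cnt B n)) \<in> negligible"
proof -
  obtain A B where AB: "A \<in> point_sets" "B \<in> point_sets"
      "\<forall>\<^sub>F n in sequentially. g n = cnt A n - cnt B n"
    using poly_bounded_eventually_cnt_diff[OF assms] by blast
  from AB(3) have "\<forall>\<^sub>F n in sequentially. g n - (cnt A n - cnt B n) = 0"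
    by eventually_elim simp
  then have "(\<lambda>n. g n - (cnt A n - cnt B n)) \<in> negligible"
    using assms AB by (intro negligible_eventually_0 poly_bounded_diff cnt_poly_bounded)
  then show ?thesis using AB by blast
qed

lemma psi_nonempty: "g \<in> poly_bounded \<Longrightarrow> \<exists>u. u \<in> psi g"
  using ex_cnt_diff_mod_negligible unfolding psi_def by blast

lemma psi_cong:
  assumes "(\<lambda>n. f n - g n) \<in> negligible"
  shows "psi f = psi g"
proof -
  have iff: "(\<lambda>n. f n - h n) \<in> negligible \<longleftrightarrow> (\<lambda>n. g n - h n) \<in> negligible" for h
    using negligible_diff[OF _ assms, of "\<lambda>n. f n - h n"] negligible_add[OF _ assms, of "\<lambda>n. g n - h n"]
    by auto
  show ?thesis
    unfolding psi_def using iff[of "\<lambda>n. cnt _ n - cnt _ n"] by simp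
qed

lemma psi_eq_iff:
  assumes "f \<in> poly_bounded" "g \<in> poly_bounded"
  shows "psi f = psi g \<longleftrightarrow> (\<lambda>n. f n - g n) \<in> negligible"
proof
  assume eq: "psi f = psi g"
  obtain u where u: "u \<in> psi f" using psi_nonempty assms by blast
  obtain A B where A: "A \<in> point_sets" "B \<in> point_sets" "u = (num A, num B)"
      "(\<lambda>n. f n - (cnt A n - cnt B n)) \<in> negligible"
    using u by (rule psiE)
  have "u \<in> psi g" using u eq by simp
  then obtain C D where C: "C \<in> point_sets" "D \<in> point_sets" "u = (num C, num D)"
      "(\<lambda>n. g n - (cnt C n - cnt D n)) \<in> negligible"
    by (rule psiE)
  have "A \<approx> C" "B \<approx> D" using A C by (auto simp flip: num_eq_iff)
  \<comment> \<open>The difference \<open>f - g\<close> is split into the two remainders and the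
    discrepancy between the two representations of the common pair.\<close>
  then have "(\<lambda>n. (f n - (cnt A n - cnt B n)) - (g n - (cnt C n - cnt D n)) +
      ((cnt A n - cnt C n) - (cnt B n - cnt D n))) \<in> negligible"
    by (intro negligible_add[OF negligible_diff[OF A(4) C(4)] negligible_diff] cnt_diff_negligible)
  then show "(\<lambda>n. f n - g n) \<in> negligible" by (simp add: algebra_simps)
qed (rule psi_cong)

lemma num_diff_num:
  assumes "A \<in> point_sets" "B \<in> point_sets"
  shows "num_diff E (num A) (num B) = psi (\<lambda>n. cnt A n - cnt B n)"
proof (intro equalityI subsetI)
  fix u assume u: "u \<in> num_diff E (num A) (num B)"
  then obtain C D where CD: "u = (num C, num D)" "C \<in> point_sets" "D \<in> point_sets"
    by (auto simp: num_diff_def diff_rel_def numerosities_eq)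
  with u show "u \<in> psi (\<lambda>n. cnt A n - cnt B n)"
    using assms unfolding num_diff_def psi_def by (auto simp: diff_rel_num_iff)
next
  fix u assume "u \<in> psi (\<lambda>n. cnt A n - cnt B n)"
  then show "u \<in> num_diff E (num A) (num B)"
    using assms by (elim psiE) (simp add: num_diff_def diff_rel_num_iff)
qed

lemma psi_image: "psi ` poly_bounded = carrier (num_ring E)"
proof -
  have "carrier (num_ring E) = {num_diff E (num A) (num B) | A B. A \<in> point_sets \<and> B \<in> point_sets}"
    by (auto simp: num_ring_def quotient_def numerosities_eq num_diff_def)
  also have "\<dots> = psi ` poly_bounded"
  proof (intro equalityI subsetI)
    fix u assume "u \<in> psi ` poly_bounded"
    then obtain g where g: "g \<in> poly_bounded" "u = psi g" by blast
    then obtain A B where AB: "A \<in> point_sets" "B \<in> point_sets"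
        "(\<lambda>n. g n - (cnt A n - cnt B n)) \<in> negligible"
      using ex_cnt_diff_mod_negligible by blast
    then have "u = num_diff E (num A) (num B)"
      using g by (simp add: num_diff_num psi_cong)
    then show "u \<in> {num_diff E (num A) (num B) | A B. A \<in> point_sets \<and> B \<in> point_sets}"
      using AB by blast
  qed (auto simp: num_diff_num cnt_diff_poly_bounded)
  finally show ?thesis by simp
qed

text \<open>The representatives of the two sums have the expected counts only eventually; the error
  is negligible and invisible to \<open>psi\<close>.\<close>

lemma num_diff_num_add:
  assumes "A \<in> point_sets" "B \<in> point_sets" "C \<in> point_sets" "D \<in> point_sets"
  shows "num_diff E (num_add E (num A) (num B)) (num_add E (num C) (num D)) =
    psi (\<lambda>n. (cnt A n + cnt B n) - (cnt C n + cnt D n))"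
proof -
  obtain X where X: "X \<in> point_sets" "num_add E (num A) (num B) = num X"
      "\<forall>\<^sub>F n in sequentially. cnt X n = cnt A n + cnt B n"
    using num_add_num assms by blast
  obtain Y where Y: "Y \<in> point_sets" "num_add E (num C) (num D) = num Y"
      "\<forall>\<^sub>F n in sequentially. cnt Y n = cnt C n + cnt D n"
    using num_add_num assms by blast
  have "\<forall>\<^sub>F n in sequentially. (cnt X n - cnt Y n) - ((cnt A n + cnt B n) - (cnt C n + cnt D n)) = 0"
    using X(3) Y(3) by eventually_elim simp
  then have "(\<lambda>n. (cnt X n - cnt Y n) - ((cnt A n + cnt B n) - (cnt C n + cnt D n))) \<in> negligible"
    using assms X Y by (intro negligible_eventually_0 poly_bounded_diff poly_bounded_add cnt_poly_bounded)
  then show ?thesis using X Y by (simp add: num_diff_num psi_cong)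
qed

lemma psi_add:
  assumes "f \<in> poly_bounded" "g \<in> poly_bounded"
  shows "psi (\<lambda>n. f n + g n) = psi f \<oplus>\<^bsub>num_ring E\<^esub> psi g"
proof -
  have "num_diff E (num_add E p r) (num_add E q s) = psi (\<lambda>n. f n + g n)"
    if "(p, q) \<in> psi f" "(r, s) \<in> psi g" for p q r s
  proof -
    from that(1) obtain A B where A: "p = num A" "q = num B" "A \<in> point_sets" "B \<in> point_sets"
        "(\<lambda>n. f n - (cnt A n - cnt B n)) \<in> negligible"
      by (auto elim: psiE)
    from that(2) obtain C D where C: "r = num C" "s = num D" "C \<in> point_sets" "D \<in> point_sets"
        "(\<lambda>n. g n - (cnt C n - cnt D n)) \<in> negligible"
      by (auto elim: psiE)
    have "(\<lambda>n. (f n - (cnt A n - cnt B n)) + (g n - (cnt C n - cnt D n))) \<in> negligible"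
      using A C by (intro negligible_add)
    also have "(\<lambda>n. (f n - (cnt A n - cnt B n)) + (g n - (cnt C n - cnt D n))) =
        (\<lambda>n. (f n + g n) - ((cnt A n + cnt C n) - (cnt B n + cnt D n)))"
      by (simp add: algebra_simps)
    finally have "psi (\<lambda>n. f n + g n) = psi (\<lambda>n. (cnt A n + cnt C n) - (cnt B n + cnt D n))"
      by (rule psi_cong)
    then show ?thesis using A C by (simp add: num_diff_num_add)
  qed
  moreover obtain u v where "u \<in> psi f" "v \<in> psi g"
    using assms psi_nonempty by blast
  ultimately show ?thesis
    unfolding num_ring_def ring.simps by (intro UN_pairs_constant[symmetric])
qed

lemma psi_mult:
  assumes "f \<in> poly_bounded" "g \<in> poly_bounded"
  shows "psi (\<lambda>n. f n * g n) = psi f \<otimes>\<^bsub>num_ring E\<^esub> psi g"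
proof -
  have "num_diff E (num_add E (num_mult E p r) (num_mult E q s)) (num_add E (num_mult E p s) (num_mult E q r))
      = psi (\<lambda>n. f n * g n)"
    if "(p, q) \<in> psi f" "(r, s) \<in> psi g" for p q r s
  proof -
    from that(1) obtain A B where A: "p = num A" "q = num B" "A \<in> point_sets" "B \<in> point_sets"
        "(\<lambda>n. f n - (cnt A n - cnt B n)) \<in> negligible"
      by (auto elim: psiE)
    from that(2) obtain C D where C: "r = num C" "s = num D" "C \<in> point_sets" "D \<in> point_sets"
        "(\<lambda>n. g n - (cnt C n - cnt D n)) \<in> negligible"
      by (auto elim: psiE)
    \<comment> \<open>Replaces the factors one at a time: first \<open>f\<close>, then
      \<open>g\<close>, by its difference of counts. Each replacement is a multiple of a negligible
      sequence.\<close>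
    have "(\<lambda>n. g n * (f n - (cnt A n - cnt B n)) + (cnt A n - cnt B n) * (g n - (cnt C n - cnt D n)))
        \<in> negligible"
      using A C assms by (intro negligible_add negligible_mult cnt_diff_poly_bounded)
    also have "(\<lambda>n. g n * (f n - (cnt A n - cnt B n)) + (cnt A n - cnt B n) * (g n - (cnt C n - cnt D n))) =
        (\<lambda>n. f n * g n - ((cnt (A \<times>\<^sub>c C) n + cnt (B \<times>\<^sub>c D) n) - (cnt (A \<times>\<^sub>c D) n + cnt (B \<times>\<^sub>c C) n)))"
      using A C by (simp add: algebra_simps cnt_set_concat)
    finally have "psi (\<lambda>n. f n * g n) =
        psi (\<lambda>n. (cnt (A \<times>\<^sub>c C) n + cnt (B \<times>\<^sub>c D) n) - (cnt (A \<times>\<^sub>c D) n + cnt (B \<times>\<^sub>c C) n))"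
      by (rule psi_cong)
    then show ?thesis using A C by (simp add: num_diff_num_add num_mult_num set_concat_point_sets)
  qed
  moreover obtain u v where "u \<in> psi f" "v \<in> psi g"
    using assms psi_nonempty by blast
  ultimately show ?thesis
    unfolding num_ring_def monoid.simps by (intro UN_pairs_constant[symmetric])
qed

section \<open>Existence and uniqueness of the numerosity homomorphism\<close>

lemma psi_cnt:
  assumes "A \<in> point_sets"
  shows "psi (cnt A) = num_embed E (num A)"
  using num_diff_num[OF assms empty_point_sets] by (simp add: num_embed_def)

lemma eqn_singletons: "p \<noteq> [] \<Longrightarrow> q \<noteq> [] \<Longrightarrow> {p} \<approx> {q}"
  by (intro eqn_of_cnt_eq singleton_point_sets
      eventually_elim2[OF eventually_cnt_singleton[of p] eventually_cnt_singleton[of q]]) simp_all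

lemma psi_one: "psi (\<lambda>n. 1) = \<one>\<^bsub>num_ring E\<^esub>"
proof -
  have "cnt {[0]} = (\<lambda>n. 1)" by (auto simp: cnt_singleton)
  then show ?thesis
    using psi_cnt[of "{[0]}"] by (simp add: singleton_point_sets num_ring_def num_embed_def)
qed

lemma psi_zero: "psi (\<lambda>n. 0) = \<zero>\<^bsub>num_ring E\<^esub>"
proof -
  have "cnt {} = (\<lambda>n. 0)" by auto
  then show ?thesis
    using psi_cnt[OF empty_point_sets] by (simp add: num_ring_def num_embed_def)
qed

lemma psi_ring_hom: "psi \<in> ring_hom poly_bounded_ring (num_ring E)"
  unfolding ring_hom_def using psi_image
  by (auto simp: poly_bounded_ring_def seq_ring_def psi_add psi_mult psi_one)

text \<open>The ring axioms are inherited from \<open>poly_bounded_ring\<close> along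
  \<open>psi\<close>. Since \<open>psi\<close> is onto and preserves zero, the image ring is
  \<open>num_ring E\<close> itself.\<close>

lemma ring_num_ring: "ring (num_ring E)"
proof -
  interpret cring poly_bounded_ring by (rule cring_poly_bounded_ring)
  have "ring (num_ring E \<lparr>carrier := psi ` carrier poly_bounded_ring, zero := psi \<zero>\<^bsub>poly_bounded_ring\<^esub>\<rparr>)"
    by (rule ring_hom_imp_img_ring[OF psi_ring_hom])
  then show ?thesis
    by (simp add: poly_bounded_ring_def seq_ring_def psi_image psi_zero)
qed

lemma numerosity_hom_psi: "numerosity_hom E psi"
  unfolding numerosity_hom_def
  using ring_num_ring psi_ring_hom cring.axioms(1)[OF cring_poly_bounded_ring] psi_image
  by (auto intro!: ring_hom_ringI2 simp: Phi_char_series psi_cnt poly_bounded_ring_def)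

text \<open>A sequence vanishing from \<open>m\<close> on is annihilated by the counting function of \<open>{[m]}\<close>, which
  every numerosity homomorphism maps to 1.\<close>

lemma numerosity_hom_eq_psi:
  assumes hom: "numerosity_hom E \<psi>" and g: "g \<in> poly_bounded"
  shows "\<psi> g = psi g"
proof -
  interpret ring_hom_ring poly_bounded_ring "num_ring E" \<psi>
    using hom by (simp add: numerosity_hom_def)
  interpret P: ring_hom_ring poly_bounded_ring "num_ring E" psi
    using numerosity_hom_psi by (simp add: numerosity_hom_def)
  have cnt: "\<psi> (cnt A) = psi (cnt A)" if "A \<in> point_sets" for A
    using that hom by (simp add: numerosity_hom_def Phi_char_series psi_cnt)
  have carrier: "carrier poly_bounded_ring = poly_bounded"
    and add: "f \<oplus>\<^bsub>poly_bounded_ring\<^esub> h = (\<lambda>n. f n + h n)"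
    and mult: "f \<otimes>\<^bsub>poly_bounded_ring\<^esub> h = (\<lambda>n. f n * h n)"
    and zero: "\<zero>\<^bsub>poly_bounded_ring\<^esub> = (\<lambda>n. 0)" for f h
    by (simp_all add: poly_bounded_ring_def seq_ring_def)
  obtain A B where AB: "A \<in> point_sets" "B \<in> point_sets"
      "\<forall>\<^sub>F n in sequentially. g n = cnt A n - cnt B n"
    using poly_bounded_eventually_cnt_diff[OF g] by blast
  \<comment> \<open>The values on counting functions are prescribed, so only this eventually
    vanishing remainder could distinguish the two homomorphisms.\<close>
  define e where "e n = g n + cnt B n - cnt A n" for n
  have e: "e \<in> poly_bounded"
    unfolding e_def[abs_def] by (intro poly_bounded_diff poly_bounded_add g cnt_poly_bounded AB)
  from AB(3) have "\<forall>\<^sub>F n in sequentially. e n = 0"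
    by eventually_elim (simp add: e_def)
  then obtain m where m: "\<And>n. n \<ge> m \<Longrightarrow> e n = 0" by (auto simp: eventually_sequentially)
  have pt: "{[m]} \<in> point_sets" by (simp add: singleton_point_sets)
  have one: "psi (cnt {[m]}) = \<one>\<^bsub>num_ring E\<^esub>"
    using eqn_singletons[of "[m]" "[0]"]
    by (simp add: psi_cnt pt num_ring_def num_embed_def numerosity_def equiv_class_eq[OF equiv])
  have e0: "e \<otimes>\<^bsub>poly_bounded_ring\<^esub> cnt {[m]} = \<zero>\<^bsub>poly_bounded_ring\<^esub>"
    using m by (auto simp: mult zero cnt_singleton fun_eq_iff)
  have "\<psi> e = \<psi> (e \<otimes>\<^bsub>poly_bounded_ring\<^esub> cnt {[m]})"
    using e one cnt[OF pt] pt by (simp add: carrier cnt_poly_bounded)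
  also have "\<dots> = \<zero>\<^bsub>num_ring E\<^esub>" unfolding e0 by (rule hom_zero)
  finally have \<psi>e: "\<psi> e = \<zero>\<^bsub>num_ring E\<^esub>" .
  have "psi e = psi (e \<otimes>\<^bsub>poly_bounded_ring\<^esub> cnt {[m]})"
    using e one pt by (simp add: carrier cnt_poly_bounded)
  also have "\<dots> = \<zero>\<^bsub>num_ring E\<^esub>" unfolding e0 by (rule P.hom_zero)
  finally have psie: "psi e = \<zero>\<^bsub>num_ring E\<^esub>" .
  \<comment> \<open>Both homomorphisms send \<open>e\<close> to zero, so applying them here and
    cancelling \<open>psi (cnt B)\<close> leaves equal values at \<open>g\<close>.\<close>
  have eq: "g \<oplus>\<^bsub>poly_bounded_ring\<^esub> cnt B = e \<oplus>\<^bsub>poly_bounded_ring\<^esub> cnt A"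
    by (auto simp: add e_def)
  have in_carrier: "g \<in> carrier poly_bounded_ring" "e \<in> carrier poly_bounded_ring"
      "cnt A \<in> carrier poly_bounded_ring" "cnt B \<in> carrier poly_bounded_ring"
    using g e AB by (simp_all add: carrier cnt_poly_bounded)
  have "\<psi> g \<oplus>\<^bsub>num_ring E\<^esub> psi (cnt B) = psi (cnt A)"
    using arg_cong[OF eq, of \<psi>] in_carrier \<psi>e cnt AB by (simp add: P.hom_closed)
  moreover have "psi g \<oplus>\<^bsub>num_ring E\<^esub> psi (cnt B) = psi (cnt A)"
    using arg_cong[OF eq, of psi] in_carrier psie by (simp add: P.hom_closed)
  ultimately show ?thesis
    using in_carrier P.hom_closed hom_closed by (metis S.add.right_cancel)
qed

text \<open>Every numerosity homomorphism agrees with \<open>psi\<close> on polynomially bounded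
  sequences, so its kernel is \<open>negligible\<close> and one ultrafilter serves them all.\<close>

lemma mem_kernel_iff:
  assumes "numerosity_hom E \<psi>" "g \<in> poly_bounded"
  shows "g \<in> a_kernel poly_bounded_ring (num_ring E) \<psi> \<longleftrightarrow> (\<forall>\<^sub>F n in zero_filter. g n = 0)"
proof -
  have "g \<in> a_kernel poly_bounded_ring (num_ring E) \<psi> \<longleftrightarrow> \<psi> g = \<zero>\<^bsub>num_ring E\<^esub>"
    using assms(2) by (simp add: a_kernel_def' poly_bounded_ring_def)
  also have "\<dots> \<longleftrightarrow> psi g = psi (\<lambda>n. 0)"
    using numerosity_hom_eq_psi[OF assms] by (simp add: psi_zero)
  also have "\<dots> \<longleftrightarrow> g \<in> negligible"
    using psi_eq_iff[OF assms(2) poly_bounded_const[of 0]] by simp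
  finally show ?thesis using eventually_zero_iff_negligible[OF assms(2)] by simp
qed

lemma eqn_iff_eventually_card_eq:
  assumes "A \<in> point_sets" "B \<in> point_sets"
  shows "A \<approx> B \<longleftrightarrow> (\<forall>\<^sub>F n in zero_filter. card (trunc A n) = card (trunc B n))"
  using eventually_zero_iff_negligible[OF cnt_diff_poly_bounded[OF assms]] cnt_diff_negligible_iff[OF assms]
  by (simp add: cnt_def)

text \<open>A numerosity homomorphism is constrained only on the carrier. Extensionality fixes the
  remaining values, so the witness is the restriction of \<open>psi\<close>.\<close>

lemma ex1_numerosity_hom:
  "\<exists>!\<psi>. \<psi> \<in> extensional (carrier poly_bounded_ring) \<and> numerosity_hom E \<psi>"
proof (rule ex1I)
  have carrier: "carrier poly_bounded_ring = poly_bounded" by (simp add: poly_bounded_ring_def)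
  let ?\<psi> = "restrict psi (carrier poly_bounded_ring)"
  interpret P: ring_hom_ring poly_bounded_ring "num_ring E" psi
    using numerosity_hom_psi by (simp add: numerosity_hom_def)
  have "ring_hom_ring poly_bounded_ring (num_ring E) ?\<psi>"
    by (rule ring_hom_ringI) (auto intro: P.R.ring_axioms P.S.ring_axioms)
  moreover have "?\<psi> ` carrier poly_bounded_ring = carrier (num_ring E)"
    by (simp add: carrier psi_image)
  ultimately have "numerosity_hom E ?\<psi>"
    using numerosity_hom_psi
    by (simp add: numerosity_hom_def Phi_char_series carrier cnt_poly_bounded)
  then show "?\<psi> \<in> extensional (carrier poly_bounded_ring) \<and> numerosity_hom E ?\<psi>"
    by simp
  fix \<psi> assume "\<psi> \<in> extensional (carrier poly_bounded_ring) \<and> numerosity_hom E \<psi>"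
  then show "\<psi> = ?\<psi>"
    by (intro extensionalityI[of _ "carrier poly_bounded_ring"])
       (auto simp: carrier numerosity_hom_eq_psi)
qed

end

theorem theorem5p2:
  shows "(ring_hom_ring series_ring seq_ring Phi \<and>
          a_kernel series_ring seq_ring Phi \<inter> positive_series = {} \<and>
          subring poly_bounded seq_ring \<and>
          Phi ` carrier series_ring = poly_bounded) \<and>
         (\<forall>E. equinumerosity E \<and> asymptotic E \<longrightarrow>
            (\<exists>!\<psi>. \<psi> \<in> extensional (carrier poly_bounded_ring) \<and> numerosity_hom E \<psi>) \<and>
            (\<forall>\<psi>. numerosity_hom E \<psi> \<longrightarrow>
               (\<exists>U. quasi_selective U \<and>
                  (\<forall>g\<in>carrier poly_bounded_ring.
                     g \<in> a_kernel poly_bounded_ring (num_ring E) \<psi> \<longleftrightarrow>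
                     (\<forall>\<^sub>F n in U. g n = 0)) \<and>
                  (\<forall>A\<in>point_sets. \<forall>B\<in>point_sets.
                     (A, B) \<in> E \<longleftrightarrow>
                     (\<forall>\<^sub>F n in U. card (trunc A n) = card (trunc B n))))))"
proof (intro conjI allI impI; (elim conjE)?)
  show "a_kernel series_ring seq_ring Phi \<inter> positive_series = {}"
    using Phi_positive_series by (auto simp: a_kernel_def' seq_ring_def)
  show "Phi ` carrier series_ring = poly_bounded"
    using Phi_range by (simp add: series_ring_def)
next
  fix E assume "equinumerosity E" "asymptotic E"
  then interpret asymptotic_equinumerosity E by unfold_locales
  show "\<exists>!\<psi>. \<psi> \<in> extensional (carrier poly_bounded_ring) \<and> numerosity_hom E \<psi>"
    by (rule ex1_numerosity_hom)
  fix \<psi> assume \<psi>: "numerosity_hom E \<psi>"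
  have "g \<in> a_kernel poly_bounded_ring (num_ring E) \<psi> \<longleftrightarrow> (\<forall>\<^sub>F n in zero_filter. g n = 0)"
    if "g \<in> carrier poly_bounded_ring" for g
    using that mem_kernel_iff[OF \<psi>] by (simp add: poly_bounded_ring_def)
  then show "\<exists>U. quasi_selective U \<and>
      (\<forall>g\<in>carrier poly_bounded_ring.
         g \<in> a_kernel poly_bounded_ring (num_ring E) \<psi> \<longleftrightarrow> (\<forall>\<^sub>F n in U. g n = 0)) \<and>
      (\<forall>A\<in>point_sets. \<forall>B\<in>point_sets.
         (A, B) \<in> E \<longleftrightarrow> (\<forall>\<^sub>F n in U. card (trunc A n) = card (trunc B n)))"
    using quasi_selective_zero_filter eqn_iff_eventually_card_eq by blast
qed (rule ring_hom_ring_Phi subring_poly_bounded)+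

end
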